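(* Let $\lambda=1/\gamma$, where $\gamma=\frac{1+\sqrt5}2$. For $z\in[0,1)^2$ the minimal period length $\pi(z)$ is: \begin{itemize} \item $1$ if $z=(0,0)$; \item $2(5\cdot4^n+4)/3$ if $S^nR(z)=\left(\frac\gamma{\gamma^2+1},\frac{1/\gamma}{\gamma^2+1}\right)$ for some $n\ge0$; \item $10(5\cdot4^n+4)/3$ for the other points with $S^nR(z)\in D_\alpha$, $n\ge0$; \item $4(5\cdot4^n-2)/3$ if $S^nR(z)=\left(\frac{\gamma^2}{\gamma^2+1},\frac1{\gamma^2+1}\right)$ for some $n\ge0$; \item $20(5\cdot4^n-2)/3$ for the other points with $S^nR(z)\in D_\beta$, $n\ge0$; \item $5(4^{n+1}-1)/3$ if $S^nR(z)=(1/2,0)$ for some $n\ge0$; \item $10(4^{n+1}-1)/3$ for the other points with $S^nR(z)\in D_3$, $n\ge0$; \item $5(2\cdot4^{n+1}+7)/3$ if $S^nR(z)=\hat T^m(1/(2\gamma),0)$ for some $m\in\{0,1,2,3\}$ and $n\ge0$; \item $10(2\cdot4^{n+1}+7)/3$ for the other points with $S^nR(z)\in\hat T^m(D_\zeta)$, $m\in\{0,1,2,3\}$, $n\ge0$; \item $(10\cdot4^n+11)/3$ if $S^nR(z)=(1/\gamma^2,0)$ for some $n\ge0$; \item $(5\cdot4^{n+1}+19)/3$ if $S^nR(z)=\hat T^m(1/\gamma^3,0)$ for some $m\in\{0,1\}$ and $n\ge0$; \item $\infty$ if $S^nR(z)\in\mathcal D\setminus\mathcal P$ for all $n\ge0$.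 \end{itemize}
   Context: $T:[0,1)^2\to[0,1)^2$ is the bijection $T(x,y)=(y,\{-x+\gamma y\})$ ($\{\cdot\}$ applied to a real number is the fractional part). $\pi(z)$ is the least $p\ge1$ with $T^p(z)=z$, and $\infty$ if none exists. $\mathcal D=\{(x,y)\in[0,1)^2:\gamma x-1<y<x/\gamma\}$; $\mathcal R=\{z\in[0,1)^2:T^m(z)\notin\mathcal D\text{ for all }m\ge0\}=\{(0,0)\}$. For $z\notin\mathcal R$, $R(z)=T^{r(z)}(z)$ with $r(z)=\min\{m\ge0:T^m(z)\in\mathcal D\}$. $\hat T:\mathcal D\to\mathcal D$ is the first return map of $T$ to $\mathcal D$, $\hat T(z)=R(T(z))$ (a bijection). $D_0=\{(x,y)\in\mathcal D:y>x-1/\gamma^2\}$, $D_1=\{(x,y)\in\mathcal D:0<y<x-1/\gamma^2\}$, $D_3=\{(x,0):1/\gamma^2<x<1/\gamma\}$; $D_\alpha=\{z\in\mathcal D:\hat T^k(z)\in D_0\text{ for all }k\in\mathbb Z\}$, $D_\beta=\{z\in\mathcal D:\hat T^k(z)\in D_1\text{ for all }k\in\mathbb Z\}$, $D_\zeta=\{(x,0):1/\gamma^3<x<1/\gamma^2\}$. $U(z)=z/\gamma^2$, and $\mathcal P=\{z\in\mathcal D:\hat T^m(z)\notin U(\mathcal D)\text{ for all }m\in\mathbb Z\}$. For $z\in\mathcal D\setminus\mathcal P$ fix $\hat s(z)$ as either $\min\{m\ge0:\hat T^m(z)\in U(\mathcal D)\}$ or $\max\{m\le0:\hat T^m(z)\in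 U(\mathcal D)\}$ (one that exists), and let $S(z)=U^{-1}\hat T^{\hat s(z)}(z)$, $S:\mathcal D\setminus\mathcal P\to\mathcal D$. For $z\notin\mathcal R$: $S^0R(z)=R(z)$, and $S^nR(z)=S(S^{n-1}R(z))$ is defined as long as $S^{n-1}R(z)$ is defined and in $\mathcal D\setminus\mathcal P$. Conditions on $S^nR(z)$ include that $z\notin\mathcal R$ and that it is defined. *)

theory Defs
  imports Complex_Main "HOL-Library.Extended_Nat"
begin

definition gr :: real where
  "gr = (1 + sqrt 5) / 2"

definition unit_square :: "(real \<times> real) set" where
  "unit_square = {0..<1} \<times> {0..<1}"

definition T :: "real \<times> real \<Rightarrow> real \<times> real" where
  "T = (\<lambda>(x, y). (y, frac (- x + gr * y)))"

definition period :: "real \<times> real \<Rightarrow> enat" where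
  "period z = (if \<exists>p\<ge>1. (T ^^ p) z = z then enat (LEAST p. p \<ge> 1 \<and> (T ^^ p) z = z) else \<infinity>)"

definition D :: "(real \<times> real) set" where
  "D = {(x, y) \<in> unit_square. gr * x - 1 < y \<and> y < x / gr}"

text \<open>The points of the square that never enter \<open>D\<close>.\<close>

definition Rset :: "(real \<times> real) set" where
  "Rset = {z \<in> unit_square. \<forall>m. (T ^^ m) z \<notin> D}"

text \<open>\<open>R\<close> is meaningful on \<open>unit_square - Rset\<close> only, and \<open>T_hat\<close> on \<open>D\<close> only.\<close>

definition R :: "real \<times> real \<Rightarrow> real \<times> real" where
  "R z = (T ^^ (LEAST m. (T ^^ m) z \<in> D)) z"

definition T_hat :: "real \<times> real \<Rightarrow> real \<times> real" where
  "T_hat z = R (T z)"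

text \<open>Integer iterates of the bijection \<open>T_hat\<close> of \<open>D\<close>.\<close>

definition T_hat_iter :: "int \<Rightarrow> real \<times> real \<Rightarrow> real \<times> real" where
  "T_hat_iter k z =
     (if k \<ge> 0 then (T_hat ^^ nat k) z else (inv_into D T_hat ^^ nat (- k)) z)"

definition D0 :: "(real \<times> real) set" where
  "D0 = {(x, y) \<in> D. y > x - 1 / gr ^ 2}"

definition D1 :: "(real \<times> real) set" where
  "D1 = {(x, y) \<in> D. 0 < y \<and> y < x - 1 / gr ^ 2}"

definition D3 :: "(real \<times> real) set" where
  "D3 = {(x, 0) | x. 1 / gr ^ 2 < x \<and> x < 1 / gr}"

definition D_alpha :: "(real \<times> real) set" where
  "D_alpha = {z \<in> D. \<forall>k. T_hat_iter k z \<in> D0}"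

definition D_beta :: "(real \<times> real) set" where
  "D_beta = {z \<in> D. \<forall>k. T_hat_iter k z \<in> D1}"

definition D_zeta :: "(real \<times> real) set" where
  "D_zeta = {(x, 0) | x. 1 / gr ^ 3 < x \<and> x < 1 / gr ^ 2}"

definition U :: "real \<times> real \<Rightarrow> real \<times> real" where
  "U = (\<lambda>(x, y). (x / gr ^ 2, y / gr ^ 2))"

definition P :: "(real \<times> real) set" where
  "P = {z \<in> D. \<forall>m. T_hat_iter m z \<notin> U ` D}"

text \<open>The function \<open>s\<close> picks, separately for each point of \<open>D - P\<close>, either the least
  nonnegative or the greatest nonpositive time at which the orbit lies in \<open>U ` D\<close>.\<close>

definition hit_choice :: "(real \<times> real \<Rightarrow> int) \<Rightarrow> bool" where
  "hit_choice s \<longleftrightarrow> (\<forall>z \<in> D - P. T_hat_iter (s z) z \<in> U ` D \<and>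
     ((0 \<le> s z \<and> (\<forall>m. 0 \<le> m \<and> T_hat_iter m z \<in> U ` D \<longrightarrow> s z \<le> m)) \<or>
      (s z \<le> 0 \<and> (\<forall>m. m \<le> 0 \<and> T_hat_iter m z \<in> U ` D \<longrightarrow> m \<le> s z))))"

lemma hit_choice_exists: "\<exists>s. hit_choice s"
proof -
  have "\<exists>k. T_hat_iter k z \<in> U ` D \<and>
     ((0 \<le> k \<and> (\<forall>m. 0 \<le> m \<and> T_hat_iter m z \<in> U ` D \<longrightarrow> k \<le> m)) \<or>
      (k \<le> 0 \<and> (\<forall>m. m \<le> 0 \<and> T_hat_iter m z \<in> U ` D \<longrightarrow> m \<le> k)))"
    if z: "z \<in> D - P" for z
  proof -
    obtain k where k: "T_hat_iter k z \<in> U ` D"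
      using z by (auto simp: P_def)
    show ?thesis
    proof (cases "k \<ge> 0")
      case True
      let ?A = "\<lambda>n. T_hat_iter (int n) z \<in> U ` D"
      have A: "?A (nat k)" using True k by simp
      have "\<forall>m. 0 \<le> m \<and> T_hat_iter m z \<in> U ` D \<longrightarrow> int (Least ?A) \<le> m"
      proof (intro allI impI)
        fix m :: int assume m: "0 \<le> m \<and> T_hat_iter m z \<in> U ` D"
        then have "?A (nat m)" by simp
        then have "Least ?A \<le> nat m" by (rule Least_le)
        then show "int (Least ?A) \<le> m" using m by linarith
      qed
      moreover have "?A (Least ?A)" using A by (rule LeastI)
      ultimately show ?thesis by (intro exI[of _ "int (Least ?A)"]) simp
    next
      case False
      let ?A = "\<lambda>n. T_hat_iter (- int n) z \<in> U ` D"
      have A: "?A (nat (- k))" using False k by simp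
      have "\<forall>m. m \<le> 0 \<and> T_hat_iter m z \<in> U ` D \<longrightarrow> m \<le> - int (Least ?A)"
      proof (intro allI impI)
        fix m :: int assume m: "m \<le> 0 \<and> T_hat_iter m z \<in> U ` D"
        then have "?A (nat (- m))" by simp
        then have "Least ?A \<le> nat (- m)" by (rule Least_le)
        then show "m \<le> - int (Least ?A)" using m by linarith
      qed
      moreover have "?A (Least ?A)" using A by (rule LeastI)
      ultimately show ?thesis by (intro exI[of _ "- int (Least ?A)"]) simp
    qed
  qed
  then show ?thesis unfolding hit_choice_def by metis
qed

definition S :: "(real \<times> real \<Rightarrow> int) \<Rightarrow> real \<times> real \<Rightarrow> real \<times> real" where
  "S s z = inv U (T_hat_iter (s z) z)"

text \<open>\<open>SR s n z\<close> is the \<open>n\<close>-th iterate of the partial map \<open>S\<close> at \<open>R z\<close>, and \<open>None\<close> where it is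
  undefined.\<close>

fun SR :: "(real \<times> real \<Rightarrow> int) \<Rightarrow> nat \<Rightarrow> real \<times> real \<Rightarrow> (real \<times> real) option" where
  "SR s 0 z = (if z \<in> unit_square - Rset then Some (R z) else None)"
| "SR s (Suc n) z =
     (case SR s n z of
        None \<Rightarrow> None
      | Some w \<Rightarrow> if w \<in> D - P then Some (S s w) else None)"

definition c_alpha :: "real \<times> real" where
  "c_alpha = (gr / (gr ^ 2 + 1), (1 / gr) / (gr ^ 2 + 1))"

definition c_beta :: "real \<times> real" where
  "c_beta = (gr ^ 2 / (gr ^ 2 + 1), 1 / (gr ^ 2 + 1))"

end

theory Submission
  imports Defs
begin

text \<open>
  The theorem rests on a self-similarity of the first return map \<open>T_hat\<close> of the triangle \<open>D\<close>.

  The line \<open>y = x - 1 / gr ^ 2\<close> and the base of the triangle cut \<open>D\<close> into four pieces \<open>D0\<close>, \<open>D1\<close>,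
  \<open>D2\<close> (the line itself) and \<open>D3\<close> on each of which the orbit under \<open>T\<close> takes the same branches
  until it is back in \<open>D\<close>, after 6, 4, 7 and 5 steps. So \<open>T_hat\<close> is a piecewise affine map
  with four explicit formulas; in suitable linear coordinates each is the restriction of a
  rotation by a multiple of a tenth of a turn.

  Shrinking by \<open>gr ^ 2\<close> commutes with taking first returns: for
  \<open>z \<in> D\<close>, the next visit to \<open>U ` D\<close> of the \<open>T_hat\<close>-orbit of \<open>U z\<close> is at
  \<open>U (T_hat z)\<close>, and on the way the orbit passes through pieces that depend only on the piece of
  \<open>z\<close>, by the substitution 0 to 010, 1 to 01110, 2 to 012 and 3 to 01112.
  Iterating this, the first return map of \<open>T\<close> to \<open>(U ^^ n) ` D\<close> is a copy of \<open>T_hat\<close>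
  (\<open>level_return\<close>), with a return time on the copy of each piece that follows the recursion given
  by the substitution. With \<open>r = (4 ^ n - 1) / 3\<close> these times are \<open>10 r + 6\<close>, \<open>20 r + 4\<close>,
  \<open>10 r + 7\<close> and \<open>20 r + 5\<close>.

  If \<open>SR s n z = Some w\<close>, then \<open>z\<close> and \<open>(U ^^ n) w\<close> lie on the same orbit of \<open>T\<close>
  (\<open>SR_same_orbit\<close>), because every application of \<open>S\<close> moves along an orbit of \<open>T_hat\<close> and then
  undoes one \<open>U\<close>. As \<open>T\<close> is injective on the square, the two points have the same period. If
  \<open>w\<close> is periodic under \<open>T_hat\<close>, the period of \<open>(U ^^ n) w\<close> is the sum of the \<open>n\<close>-th return
  times over the cycle of \<open>w\<close> (\<open>period_level\<close>). All formulas of the theorem arise from the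
  cycles of \<open>T_hat\<close> of lengths 1, 2, 4, 5 and 8. If \<open>S\<close> can be applied for ever, then the
  period of \<open>z\<close> is at least the return time at every level \<open>n\<close>, and these times are unbounded, so
  the period is infinite.

  That one of the cases always occurs needs two more facts. Every point of the square other than
  the origin reaches \<open>D\<close> (\<open>Rset_subset\<close>), since \<open>T\<close> rotates the quadrant
  towards \<open>D\<close> as long as it does not jump, and after at most two jumps it does not jump again before
  the orbit arrives. And a point of \<open>P\<close>, whose \<open>T_hat\<close>-orbit avoids \<open>U ` D\<close>, belongs to one of the
  listed sets (\<open>P_subset\<close>): outside \<open>U ` D\<close> the only transitions between pieces that do not lead
  into \<open>U ` D\<close> are the ones that stay in \<open>D0\<close>, in \<open>D1\<close> or in \<open>D3\<close>, and those through the segment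
  \<open>D2\<close>, which \<open>T_hat\<close> maps to the base of the triangle.
\<close>

section \<open>Linear inequalities with coefficients in the golden field\<close>

lemma gr_gr: "gr * gr = gr + 1"
  unfolding gr_def by (simp add: field_simps)

lemma gr_gr_left: "gr * (gr * a) = gr * a + a"
  by (metis gr_gr mult.assoc distrib_right mult_1)

lemma gr_bounds: "8 < 5 * gr" "8 * gr < 13"
proof -
  have "11 / 5 < sqrt 5"
    by (rule real_less_rsqrt) (simp add: power2_eq_square)
  moreover have "sqrt 5 < 9 / 4"
    by (rule real_less_lsqrt) (simp_all add: power2_eq_square)
  ultimately show "8 < 5 * gr" "8 * gr < 13"
    unfolding gr_def by simp_all
qed

lemma gr_gt_1: "1 < gr"
  using gr_bounds by simp

text \<open>
  These rules turn an expression that is linear in real unknowns \<open>x\<close>, \<open>y\<close> with coefficients in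
  \<open>\<int>[gr]\<close> into a rational linear combination of \<open>x\<close>, \<open>y\<close>, \<open>gr * x\<close>, \<open>gr * y\<close>, \<open>gr\<close>
  and 1, so that \<open>linarith\<close> can treat the products with \<open>gr\<close> as further unknowns.
\<close>

lemmas gr_simps = distrib_left right_diff_distrib gr_gr gr_gr_left mult_1_right
  minus_mult_right [symmetric] mult_zero_right mult.left_commute [of gr "numeral k" for k]

text \<open>Rational linear arithmetic knows nothing about multiplying an inequality by a positive element of
  the golden field. The factors \<open>5 * gr - 8\<close> and \<open>13 - 8 * gr\<close> are the powers \<open>gr ^ (-5)\<close> and
  \<open>gr ^ (-6)\<close>; their nonnegative rational combinations contain 1 and all powers of \<open>gr\<close> from
  there on, so that the two multiples of each inequality provide all the multiples that occur below.\<close>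

lemma gr_scale:
  "a < b \<Longrightarrow> 5 * (gr * a) - 8 * a < 5 * (gr * b) - 8 * b \<and>
             13 * a - 8 * (gr * a) < 13 * b - 8 * (gr * b)"
  using mult_strict_left_mono[of a b "5 * gr - 8"] mult_strict_left_mono[of a b "13 - 8 * gr"]
    gr_bounds
  by (simp add: algebra_simps)

lemma gr_scale_le:
  "a \<le> b \<Longrightarrow> 5 * (gr * a) - 8 * a \<le> 5 * (gr * b) - 8 * b \<and>
             13 * a - 8 * (gr * a) \<le> 13 * b - 8 * (gr * b)"
  using mult_left_mono[of a b "5 * gr - 8"] mult_left_mono[of a b "13 - 8 * gr"] gr_bounds
  by (simp add: algebra_simps)

lemma gr_inverse: "1 / gr = gr - 1"
  using gr_gt_1 gr_gr by (simp add: field_simps)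

lemma gr_inverse2: "1 / gr ^ 2 = 2 - gr"
  using gr_gt_1 gr_gr by (simp add: field_simps power2_eq_square gr_gr_left)

lemma gr_inverse3: "1 / gr ^ 3 = 2 * gr - 3"
  using gr_gt_1 gr_gr by (simp add: field_simps power3_eq_cube gr_gr_left)

section \<open>The triangle and its pieces\<close>

lemma D_iff: "(x, y) \<in> D \<longleftrightarrow> 0 \<le> y \<and> gr * x < y + 1 \<and> gr * y < x"
proof -
  have eq: "y < x / gr \<longleftrightarrow> gr * y < x"
    using gr_gt_1 by (simp add: field_simps)
  have "x < 1 \<and> y < 1 \<and> 0 \<le> x" if "0 \<le> y" "gr * x < y + 1" "gr * y < x"
    using that gr_scale[OF that(2)] gr_scale[OF that(3)] gr_scale_le[OF that(1)] gr_bounds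
    unfolding gr_simps by linarith
  then show ?thesis
    unfolding D_def unit_square_def eq[symmetric] by (auto simp: eq)
qed

lemma D_subset_unit_square: "D \<subseteq> unit_square"
  unfolding D_def by auto

text \<open>The three defining inequalities of \<open>D\<close> together with their multiples as in \<open>gr_scale\<close>.\<close>

lemma D_bounds:
  assumes "(x, y) \<in> D"
  shows "0 \<le> y" "gr * x < y + 1" "gr * y < x"
    "8 * y \<le> 5 * (gr * y)" "8 * (gr * y) \<le> 13 * y"
    "5 * x + 8 * y + 8 < 3 * (gr * x) + 5 * (gr * y) + 5 * gr"
    "8 * (gr * y) + 8 * gr + 5 * (gr * x) < 8 * x + 13 * y + 13"
    "8 * x + 5 * y < 5 * (gr * x) + 3 * (gr * y)"
    "8 * (gr * x) + 5 * (gr * y) < 13 * x + 8 * y"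
    "8 < 5 * gr" "8 * gr < 13"
  using assms gr_bounds gr_scale[of "gr * x" "y + 1"] gr_scale[of "gr * y" x] gr_scale_le[of 0 y]
  unfolding D_iff gr_simps by (auto simp: algebra_simps)

text \<open>The piece that separates \<open>D0\<close> from \<open>D1\<close>; on it the return takes one step more than on \<open>D0\<close>.\<close>

definition D2 :: "(real \<times> real) set" where
  "D2 = {(x, y) \<in> D. y = x - 1 / gr ^ 2}"

lemma D0_iff: "(x, y) \<in> D0 \<longleftrightarrow> (x, y) \<in> D \<and> x + gr < y + 2"
  unfolding D0_def gr_inverse2 by auto

lemma D1_iff: "(x, y) \<in> D1 \<longleftrightarrow> (x, y) \<in> D \<and> 0 < y \<and> y + 2 < x + gr"
  unfolding D1_def gr_inverse2 by auto

lemma D2_iff: "(x, y) \<in> D2 \<longleftrightarrow> (x, y) \<in> D \<and> y + 2 = x + gr"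
  unfolding D2_def gr_inverse2 by auto

lemma D3_iff: "(x, y) \<in> D3 \<longleftrightarrow> y = 0 \<and> 2 < x + gr \<and> x + 1 < gr"
  unfolding D3_def gr_inverse2 gr_inverse by auto

lemma D3_iff_D: "(x, y) \<in> D3 \<longleftrightarrow> (x, y) \<in> D \<and> y = 0 \<and> 2 < x + gr"
  using gr_scale[of "gr * x" 1] gr_scale[of x "gr - 1"] gr_scale[of x "gr - 1"] gr_bounds
  unfolding D3_iff D_iff gr_simps by auto

section \<open>First returns\<close>

definition first_return :: "('a \<Rightarrow> 'a) \<Rightarrow> 'a set \<Rightarrow> 'a \<Rightarrow> nat \<Rightarrow> 'a \<Rightarrow> bool" where
  "first_return f E z n w \<longleftrightarrow>
     0 < n \<and> (f ^^ n) z = w \<and> w \<in> E \<and> (\<forall>k. 0 < k \<and> k < n \<longrightarrow> (f ^^ k) z \<notin> E)"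

lemma first_return_1: "f z \<in> E \<Longrightarrow> first_return f E z 1 (f z)"
  by (simp add: first_return_def)

lemma first_return_Suc:
  assumes "f z \<notin> E" "first_return f E (f z) n w"
  shows "first_return f E z (Suc n) w"
proof -
  have "(f ^^ k) z \<notin> E" if "0 < k" "k < Suc n" for k
    using that assms by (cases k; cases "k = 1")
      (auto simp: first_return_def funpow_Suc_right simp del: funpow.simps)
  with assms show ?thesis
    by (auto simp: first_return_def funpow_Suc_right simp del: funpow.simps)
qed

lemma first_return_subset:
  "first_return f E z n w \<Longrightarrow> E' \<subseteq> E \<Longrightarrow> w \<in> E' \<Longrightarrow> first_return f E' z n w"
  unfolding first_return_def by blast

text \<open>Nested sets: an orbit that waits for a visit to the smaller set can be followed along its visits
  to the larger one. Both the passage from one level of the self-similarity to the next and the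
  computation of the length of a cycle are repeated uses of this.\<close>

lemma first_return_trans:
  assumes 1: "first_return f E z n v" and "E' \<subseteq> E" "v \<notin> E'"
    and 2: "first_return f E' v m w"
  shows "first_return f E' z (n + m) w"
  unfolding first_return_def
proof (intro conjI allI impI)
  show "(f ^^ (n + m)) z = w"
    using 1 2 by (simp add: first_return_def add.commute[of n] funpow_add)
  fix k assume k: "0 < k \<and> k < n + m"
  have "(f ^^ k) z = (f ^^ (k - n)) v" if "n \<le> k"
  proof -
    have "(f ^^ k) z = (f ^^ (k - n + n)) z" using that by simp
    also have "\<dots> = (f ^^ (k - n)) v"
      using 1 by (simp only: funpow_add first_return_def o_apply)
    finally show ?thesis .
  qed
  moreover have "k < n \<or> k = n \<or> n < k \<and> k - n < m" using k by linarith
  ultimately show "(f ^^ k) z \<notin> E'"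
    using assms k by (auto simp: first_return_def)
qed (use 1 2 in \<open>auto simp: first_return_def\<close>)

section \<open>The first return map of the triangle\<close>

lemma T_eq:
  assumes "v = - x + gr * y - c" "0 \<le> v" "v < 1" "c \<in> \<int>"
  shows "T (x, y) = (y, v)"
proof -
  have "frac (- x + gr * y) = v"
    using assms by (simp add: frac_unique_iff)
  then show ?thesis unfolding T_def by simp
qed

text \<open>One step of \<open>T\<close> with \<open>c\<close> the integer part that is subtracted. This and the next two lemmas differ
  in where the step arrives: in \<open>D\<close>, or to the left of \<open>D\<close>, or to the right of \<open>D\<close>.\<close>

lemma first_return_T_last:
  assumes "c \<in> \<int>" "v = - x + gr * y - c" "0 \<le> v" "v < 1" "gr * y < v + 1" "gr * v < y"
  shows "first_return T D (x, y) 1 (y, v)"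
  using first_return_1[of T "(x, y)" D] T_eq[of v x y c] assms by (simp add: D_iff)

lemma first_return_T_left:
  assumes "first_return T D (y, v) n w" "m = Suc n"
    and "c \<in> \<int>" "v = - x + gr * y - c" "0 \<le> v" "v < 1" "y \<le> gr * v"
  shows "first_return T D (x, y) m w"
  using first_return_Suc[of T "(x, y)" D] T_eq[of v x y c] assms by (simp add: D_iff)

lemma first_return_T_right:
  assumes "first_return T D (y, v) n w" "m = Suc n"
    and "c \<in> \<int>" "v = - x + gr * y - c" "0 \<le> v" "v < 1" "v + 1 \<le> gr * y"
  shows "first_return T D (x, y) m w"
  using first_return_Suc[of T "(x, y)" D] T_eq[of v x y c] assms by (simp add: D_iff)

text \<open>The return paths are built from their last step backwards; the displayed points are the successive
  images of \<open>(x, y)\<close>, in reverse order.\<close>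

lemma first_return_D0:
  assumes "(x, y) \<in> D0"
  shows "first_return T D (x, y) 6 (gr - 1 - y, x - gr * y)"
    (is "first_return T D _ _ ?w")
proof -
  have d: "(x, y) \<in> D" and h: "x + gr < y + 2" using assms by (auto simp: D0_iff)
  note I = D_bounds[OF d] h gr_scale[OF h, unfolded gr_simps]
  have "first_return T D (1 - x, gr - 1 - y) 1 ?w"
    by (rule first_return_T_last[where c = 0], simp)
       (insert I, unfold gr_simps, linarith+)
  then have "first_return T D (1 - gr * x + y, 1 - x) 2 ?w"
    by (rule first_return_T_left[where c = 0], simp, simp)
       (insert I, unfold gr_simps, linarith+)
  then have "first_return T D (gr - 1 - gr * x + gr * y, 1 - gr * x + y) 3 ?w"
    by (rule first_return_T_left[where c = 0], simp, simp)
       (insert I, unfold gr_simps, linarith+)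
  then have "first_return T D (1 - x + gr * y, gr - 1 - gr * x + gr * y) 4 ?w"
    by (rule first_return_T_left[where c = "-1"], simp, simp)
       (insert I, unfold gr_simps, linarith+)
  then have "first_return T D (y, 1 - x + gr * y) 5 ?w"
    by (rule first_return_T_right[where c = 1], simp, simp)
       (insert I, unfold gr_simps, linarith+)
  then have "first_return T D (x, y) 6 ?w"
    by (rule first_return_T_left[where c = "-1"], simp, simp)
       (insert I, unfold gr_simps, linarith+)
  then show ?thesis .
qed

lemma first_return_D1:
  assumes "(x, y) \<in> D1"
  shows "first_return T D (x, y) 4 (gr - gr * x + y, 1 - x)"
    (is "first_return T D _ _ ?w")
proof -
  have d: "(x, y) \<in> D" and h: "0 < y" "y + 2 < x + gr" using assms by (auto simp: D1_iff)
  note I = D_bounds[OF d] h h[THEN gr_scale, unfolded gr_simps]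
  have "first_return T D (gr - gr * x + gr * y, gr - gr * x + y) 1 ?w"
    by (rule first_return_T_last[where c = 0], simp)
       (insert I, unfold gr_simps, linarith+)
  then have "first_return T D (1 - x + gr * y, gr - gr * x + gr * y) 2 ?w"
    by (rule first_return_T_left[where c = 0], simp, simp)
       (insert I, unfold gr_simps, linarith+)
  then have "first_return T D (y, 1 - x + gr * y) 3 ?w"
    by (rule first_return_T_left[where c = 0], simp, simp)
       (insert I, unfold gr_simps, linarith+)
  then have "first_return T D (x, y) 4 ?w"
    by (rule first_return_T_left[where c = "-1"], simp, simp)
       (insert I, unfold gr_simps, linarith+)
  then show ?thesis .
qed

text \<open>The path of \<open>D0\<close> now ends on the side \<open>gr * y = x\<close>, which does not belong to \<open>D\<close>. The seventh step
  leads to the base.\<close>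

lemma first_return_D2:
  assumes "(x, y) \<in> D2"
  shows "first_return T D (x, y) 7 (gr - 1 - gr * x + x, 0)" (is "first_return T D _ _ ?w")
proof -
  have d: "(x, y) \<in> D" and h: "y + 2 = x + gr" using assms by (auto simp: D2_iff)
  have h': "gr * y + gr = gr * x + 1"
    using arg_cong[OF h, of "\<lambda>t. gr * t", unfolded gr_simps] by linarith
  note I = D_bounds[OF d] h h'
  have e: "x - gr * y = gr - 1 - gr * x + x" using h' by linarith
  have "first_return T D (gr - 1 - y, x - gr * y) 1 ?w"
    unfolding e by (rule first_return_T_last[where c = 0], simp)
       (insert I, unfold gr_simps, linarith+)
  then have "first_return T D (1 - x, gr - 1 - y) 2 ?w"
    by (rule first_return_T_left[where c = 0], simp, simp)
       (insert I, unfold gr_simps, linarith+)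
  then have "first_return T D (1 - gr * x + y, 1 - x) 3 ?w"
    by (rule first_return_T_left[where c = 0], simp, simp)
       (insert I, unfold gr_simps, linarith+)
  then have "first_return T D (gr - 1 - gr * x + gr * y, 1 - gr * x + y) 4 ?w"
    by (rule first_return_T_left[where c = 0], simp, simp)
       (insert I, unfold gr_simps, linarith+)
  then have "first_return T D (1 - x + gr * y, gr - 1 - gr * x + gr * y) 5 ?w"
    by (rule first_return_T_left[where c = "-1"], simp, simp)
       (insert I, unfold gr_simps, linarith+)
  then have "first_return T D (y, 1 - x + gr * y) 6 ?w"
    by (rule first_return_T_right[where c = 1], simp, simp)
       (insert I, unfold gr_simps, linarith+)
  then have "first_return T D (x, y) 7 ?w"
    by (rule first_return_T_left[where c = "-1"], simp, simp)
       (insert I, unfold gr_simps, linarith+)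
  then show ?thesis .
qed

lemma first_return_D3:
  assumes "(x, 0) \<in> D3"
  shows "first_return T D (x, 0) 5 (1 - x, 0)"
    (is "first_return T D _ _ ?w")
proof -
  have d: "(x, 0) \<in> D" and h: "2 < x + gr" using assms by (auto simp: D3_iff_D)
  note I = D_bounds[OF d, unfolded mult_zero_right] h h[THEN gr_scale, unfolded gr_simps]
  have "first_return T D (gr - gr * x, 1 - x) 1 ?w"
    by (rule first_return_T_last[where c = 0], simp)
       (insert I, unfold gr_simps, linarith+)
  then have "first_return T D (gr - gr * x, gr - gr * x) 2 ?w"
    by (rule first_return_T_left[where c = 0], simp, simp)
       (insert I, unfold gr_simps, linarith+)
  then have "first_return T D (1 - x, gr - gr * x) 3 ?w"
    by (rule first_return_T_left[where c = 0], simp, simp)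
       (insert I, unfold gr_simps, linarith+)
  then have "first_return T D (0, 1 - x) 4 ?w"
    by (rule first_return_T_left[where c = 0], simp, simp)
       (insert I, unfold gr_simps, linarith+)
  then have "first_return T D (x, 0) 5 ?w"
    by (rule first_return_T_left[where c = "-1"], simp, simp)
       (insert I, unfold gr_simps, linarith+)
  then show ?thesis .
qed

lemma T_hat_eq:
  assumes "first_return T D z n w"
  shows "T_hat z = w"
proof -
  have fr: "0 < n" "(T ^^ n) z = w" "w \<in> D" "\<And>k. 0 < k \<Longrightarrow> k < n \<Longrightarrow> (T ^^ k) z \<notin> D"
    using assms by (auto simp: first_return_def)
  have "(LEAST m. (T ^^ m) (T z) \<in> D) = n - 1"
  proof (rule Least_equality)
    show "(T ^^ (n - 1)) (T z) \<in> D"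
      using fr by (cases n) (auto simp: funpow_Suc_right simp del: funpow.simps)
    show "n - 1 \<le> m" if "(T ^^ m) (T z) \<in> D" for m
      using that fr(4)[of "Suc m"] by (fastforce simp: funpow_Suc_right simp del: funpow.simps)
  qed
  then show ?thesis
    using fr unfolding T_hat_def R_def
    by (cases n) (auto simp: funpow_Suc_right simp del: funpow.simps)
qed

lemma T_hat_D0: "(x, y) \<in> D0 \<Longrightarrow> T_hat (x, y) = (gr - 1 - y, x - gr * y)"
  by (rule T_hat_eq[OF first_return_D0])

lemma T_hat_D1: "(x, y) \<in> D1 \<Longrightarrow> T_hat (x, y) = (gr - gr * x + y, 1 - x)"
  by (rule T_hat_eq[OF first_return_D1])

lemma T_hat_D2: "(x, y) \<in> D2 \<Longrightarrow> T_hat (x, y) = (gr - 1 - gr * x + x, 0)"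
  by (rule T_hat_eq[OF first_return_D2])

lemma T_hat_D3: "(x, 0) \<in> D3 \<Longrightarrow> T_hat (x, 0) = (1 - x, 0)"
  by (rule T_hat_eq[OF first_return_D3])

text \<open>The number \<open>(4 ^ n - 1) / 3\<close>, whose base 4 digits are \<open>n\<close> ones.\<close>

fun repunit :: "nat \<Rightarrow> nat" where
  "repunit 0 = 0"
| "repunit (Suc n) = 4 * repunit n + 1"

text \<open>The return times to \<open>(U ^^ n) ` D\<close>. They solve the recursion of the substitution: for example
  the time for \<open>D0\<close> at level \<open>n + 1\<close> is twice the time for \<open>D0\<close> plus the time for \<open>D1\<close> at
  level \<open>n\<close>.\<close>

definition level_time :: "nat \<Rightarrow> real \<times> real \<Rightarrow> nat" where
  "level_time n z =
     (if z \<in> D3 then 20 * repunit n + 5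
      else if z \<in> D2 then 10 * repunit n + 7
      else if z \<in> D1 then 20 * repunit n + 4
      else 10 * repunit n + 6)"

lemma level_time_simps:
  "z \<in> D0 \<Longrightarrow> level_time n z = 10 * repunit n + 6"
  "z \<in> D1 \<Longrightarrow> level_time n z = 20 * repunit n + 4"
  "z \<in> D2 \<Longrightarrow> level_time n z = 10 * repunit n + 7"
  "z \<in> D3 \<Longrightarrow> level_time n z = 20 * repunit n + 5"
  by (cases z; auto simp: level_time_def D0_iff D1_iff D2_iff D3_iff)+

lemma D_cases:
  assumes "z \<in> D"
  obtains (D0) "z \<in> D0" | (D1) "z \<in> D1" | (D2) "z \<in> D2" | (D3) "z \<in> D3"
proof -
  obtain x y where z: "z = (x, y)" by force
  have "z \<in> D0 \<or> z \<in> D1 \<or> z \<in> D2 \<or> z \<in> D3"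
    using assms unfolding z D0_iff D1_iff D2_iff D3_iff_D by (auto simp: D_iff)
  with that show ?thesis by blast
qed

lemma D_pieces_subset: "D0 \<subseteq> D" "D1 \<subseteq> D" "D2 \<subseteq> D" "D3 \<subseteq> D"
  by (auto simp: D0_iff D1_iff D2_iff D3_iff_D)

lemma first_return_T_hat:
  assumes "z \<in> D"
  shows "first_return T D z (level_time 0 z) (T_hat z)"
  using assms
proof (cases rule: D_cases)
  case D0
  then show ?thesis
    by (cases z) (auto simp: level_time_simps T_hat_D0 first_return_D0)
next
  case D1
  then show ?thesis
    by (cases z) (auto simp: level_time_simps T_hat_D1 first_return_D1)
next
  case D2
  then show ?thesis
    by (cases z) (auto simp: level_time_simps T_hat_D2 first_return_D2)
next
  case D3
  moreover obtain x where "z = (x, 0)" using D3 by (cases z) (auto simp: D3_iff)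
  ultimately show ?thesis
    by (auto simp: level_time_simps T_hat_D3 first_return_D3)
qed

lemma T_hat_in_D: "z \<in> D \<Longrightarrow> T_hat z \<in> D"
  using first_return_T_hat by (auto simp: first_return_def)

section \<open>The self-similarity\<close>

lemma U_eq: "U (x, y) = (2 * x - gr * x, 2 * y - gr * y)"
proof -
  have "a / gr ^ 2 = 2 * a - gr * a" for a
    using gr_inverse2 by (metis divide_inverse_commute inverse_eq_divide left_diff_distrib)
  then show ?thesis by (simp add: U_def)
qed

lemma inj_U: "inj U"
  using gr_gt_1 by (auto simp: inj_def U_def)

lemma UD_iff: "(x, y) \<in> U ` D \<longleftrightarrow> 0 \<le> y \<and> gr * x + gr < y + 2 \<and> gr * y < x"
proof -
  have "(x, y) = U (gr * x + x, gr * y + y)"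
    unfolding U_eq gr_simps by simp
  then have "(x, y) \<in> U ` D \<longleftrightarrow> (gr * x + x, gr * y + y) \<in> D"
    using inj_U by (metis inj_image_mem_iff)
  also have "\<dots> \<longleftrightarrow> 0 \<le> y \<and> gr * x + gr < y + 2 \<and> gr * y < x"
  proof
    assume "(gr * x + x, gr * y + y) \<in> D"
    note b = D_bounds[OF this, unfolded gr_simps]
    show "0 \<le> y \<and> gr * x + gr < y + 2 \<and> gr * y < x"
      using b by linarith
  next
    assume "0 \<le> y \<and> gr * x + gr < y + 2 \<and> gr * y < x"
    then have a: "0 \<le> y" "gr * x + gr < y + 2" "gr * y < x" by auto
    show "(gr * x + x, gr * y + y) \<in> D"
      unfolding D_iff using a a(2,3)[THEN gr_scale, unfolded gr_simps] gr_scale_le[OF a(1)]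
      unfolding gr_simps by auto
  qed
  finally show ?thesis .
qed

text \<open>Hence only visits to \<open>D0\<close> have to be compared with \<open>U ` D\<close>.\<close>

lemma UD_subset: "U ` D \<subseteq> D0"
proof -
  have "U (x, y) \<in> D0" if d: "(x, y) \<in> D" for x y
  proof -
    note I = D_bounds[OF d]
    show ?thesis
      unfolding U_eq D0_iff D_iff gr_simps by (insert I, intro conjI; linarith)
  qed
  then show ?thesis by auto
qed

lemma outside_UD:
  "(x, y) \<in> D0 \<Longrightarrow> y + 2 \<le> gr * x + gr \<Longrightarrow> (x, y) \<in> D0 - U ` D"
  by (simp add: UD_iff)

lemma D_pieces_disjoint: "z \<in> D1 \<Longrightarrow> z \<notin> D0" "z \<in> D2 \<Longrightarrow> z \<notin> D0"
  by (cases z; auto simp: D0_iff D1_iff D2_iff)+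

lemma D1_outside_UD: "z \<in> D1 \<Longrightarrow> z \<in> D1 - U ` D"
  using UD_subset D_pieces_disjoint(1) by blast

lemma D2_outside_UD: "z \<in> D2 \<Longrightarrow> z \<in> D2 - U ` D"
  using UD_subset D_pieces_disjoint(2) by blast

text \<open>This and the following three lemmas are the substitution. For \<open>z\<close> in a piece, \<open>U z\<close> travels
  under \<open>T_hat\<close> through the pieces of the substituted word until it reaches the shrunk image of
  \<open>T_hat z\<close>, and in between it avoids \<open>U ` D\<close>.\<close>

lemma U_path_D0:
  assumes "z \<in> D0"
  shows "U z \<in> D0" "T_hat (U z) \<in> D1 - U ` D" "T_hat (T_hat (U z)) \<in> D0 - U ` D"
    "T_hat (T_hat (T_hat (U z))) = U (T_hat z)"
proof -
  obtain x y where z: "z = (x, y)" by force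
  have d: "(x, y) \<in> D" and h: "x + gr < y + 2" using assms by (auto simp: D0_iff z)
  note I = D_bounds[OF d] h gr_scale[OF h, unfolded gr_simps]
  have u: "U z = (2 * x - gr * x, 2 * y - gr * y)" by (simp add: z U_eq)
  show v0: "U z \<in> D0"
    unfolding u D0_iff D_iff gr_simps by (insert I, intro conjI; linarith)
  have e1: "T_hat (U z) = (gr * y + gr - 1 - 2 * y, 2 * x + y - gr * x - gr * y)"
    unfolding u T_hat_D0[OF v0[unfolded u]]
    by (rule prod_eqI; simp only: fst_conv snd_conv gr_simps; linarith)
  have v1: "T_hat (U z) \<in> D1"
    unfolding e1 D1_iff D_iff gr_simps by (insert I, intro conjI; linarith)
  have e2: "T_hat (T_hat (U z)) = (2 * x - gr * x - 1 + gr, 2 * y + 2 - gr * y - gr)"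
    unfolding e1 T_hat_D1[OF v1[unfolded e1]]
    by (rule prod_eqI; simp only: fst_conv snd_conv gr_simps; linarith)
  have v2: "T_hat (T_hat (U z)) \<in> D0"
    unfolding e2 D0_iff D_iff gr_simps by (insert I, intro conjI; linarith)
  show "T_hat (U z) \<in> D1 - U ` D" using v1 by (rule D1_outside_UD)
  show "T_hat (T_hat (U z)) \<in> D0 - U ` D"
    using v2 unfolding e2 by (rule outside_UD) (insert I, unfold gr_simps, linarith)
  show "T_hat (T_hat (T_hat (U z))) = U (T_hat z)"
    unfolding e2 T_hat_D0[OF v2[unfolded e2]]
    unfolding z T_hat_D0[OF assms[unfolded z]] U_eq
    by (rule prod_eqI; simp only: fst_conv snd_conv gr_simps; linarith)
qed

lemma U_path_D1:
  assumes "z \<in> D1"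
  shows "U z \<in> D0" "T_hat (U z) \<in> D1 - U ` D" "T_hat (T_hat (U z)) \<in> D1 - U ` D"
    "T_hat (T_hat (T_hat (U z))) \<in> D1 - U ` D"
    "T_hat (T_hat (T_hat (T_hat (U z)))) \<in> D0 - U ` D"
    "T_hat (T_hat (T_hat (T_hat (T_hat (U z))))) = U (T_hat z)"
proof -
  obtain x y where z: "z = (x, y)" by force
  have d: "(x, y) \<in> D" and h: "0 < y" "y + 2 < x + gr" using assms by (auto simp: D1_iff z)
  note I = D_bounds[OF d] h h[THEN gr_scale, unfolded gr_simps]
  have u: "U z = (2 * x - gr * x, 2 * y - gr * y)" by (simp add: z U_eq)
  show v0: "U z \<in> D0"
    unfolding u D0_iff D_iff gr_simps by (insert I, intro conjI; linarith)
  have e1: "T_hat (U z) = (gr * y + gr - 1 - 2 * y, 2 * x + y - gr * x - gr * y)"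
    unfolding u T_hat_D0[OF v0[unfolded u]]
    by (rule prod_eqI; simp only: fst_conv snd_conv gr_simps; linarith)
  have v1: "T_hat (U z) \<in> D1"
    unfolding e1 D1_iff D_iff gr_simps by (insert I, intro conjI; linarith)
  have e2: "T_hat (T_hat (U z)) = (2 * x - gr * x - 1 + gr, 2 * y + 2 - gr * y - gr)"
    unfolding e1 T_hat_D1[OF v1[unfolded e1]]
    by (rule prod_eqI; simp only: fst_conv snd_conv gr_simps; linarith)
  have v2: "T_hat (T_hat (U z)) \<in> D1"
    unfolding e2 D1_iff D_iff gr_simps by (insert I, intro conjI; linarith)
  have e3: "T_hat (T_hat (T_hat (U z))) = (x - gr * x + 2 * y - gr * y + 1, gr * x - 2 * x + 2 - gr)"
    unfolding e2 T_hat_D1[OF v2[unfolded e2]]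
    by (rule prod_eqI; simp only: fst_conv snd_conv gr_simps; linarith)
  have v3: "T_hat (T_hat (T_hat (U z))) \<in> D1"
    unfolding e3 D1_iff D_iff gr_simps by (insert I, intro conjI; linarith)
  have e4: "T_hat (T_hat (T_hat (T_hat (U z)))) =
      (gr * x - x + y - gr * y + 2 - gr, gr * x - x - 2 * y + gr * y)"
    unfolding e3 T_hat_D1[OF v3[unfolded e3]]
    by (rule prod_eqI; simp only: fst_conv snd_conv gr_simps; linarith)
  have v4: "T_hat (T_hat (T_hat (T_hat (U z)))) \<in> D0"
    unfolding e4 D0_iff D_iff gr_simps by (insert I, intro conjI; linarith)
  show "T_hat (U z) \<in> D1 - U ` D" using v1 by (rule D1_outside_UD)
  show "T_hat (T_hat (U z)) \<in> D1 - U ` D" using v2 by (rule D1_outside_UD)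
  show "T_hat (T_hat (T_hat (U z))) \<in> D1 - U ` D" using v3 by (rule D1_outside_UD)
  show "T_hat (T_hat (T_hat (T_hat (U z)))) \<in> D0 - U ` D"
    using v4 unfolding e4 by (rule outside_UD) (insert I, unfold gr_simps, linarith)
  show "T_hat (T_hat (T_hat (T_hat (T_hat (U z))))) = U (T_hat z)"
    unfolding e4 T_hat_D0[OF v4[unfolded e4]]
    unfolding z T_hat_D1[OF assms[unfolded z]] U_eq
    by (rule prod_eqI; simp only: fst_conv snd_conv gr_simps; linarith)
qed

lemma U_path_D2:
  assumes "z \<in> D2"
  shows "U z \<in> D0" "T_hat (U z) \<in> D1 - U ` D" "T_hat (T_hat (U z)) \<in> D2 - U ` D"
    "T_hat (T_hat (T_hat (U z))) = U (T_hat z)"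
proof -
  obtain x y where z: "z = (x, y)" by force
  have d: "(x, y) \<in> D" and h: "y + 2 = x + gr" using assms by (auto simp: D2_iff z)
  have h': "gr * y + gr = gr * x + 1"
    using arg_cong[OF h, of "\<lambda>t. gr * t", unfolded gr_simps] by linarith
  note I = D_bounds[OF d] h h'
  have u: "U z = (2 * x - gr * x, 2 * y - gr * y)" by (simp add: z U_eq)
  show v0: "U z \<in> D0"
    unfolding u D0_iff D_iff gr_simps by (insert I, intro conjI; linarith)
  have e1: "T_hat (U z) = (gr * y + gr - 1 - 2 * y, 2 * x + y - gr * x - gr * y)"
    unfolding u T_hat_D0[OF v0[unfolded u]]
    by (rule prod_eqI; simp only: fst_conv snd_conv gr_simps; linarith)
  have v1: "T_hat (U z) \<in> D1"
    unfolding e1 D1_iff D_iff gr_simps by (insert I, intro conjI; linarith)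
  have e2: "T_hat (T_hat (U z)) = (2 * x - gr * x - 1 + gr, 2 * y + 2 - gr * y - gr)"
    unfolding e1 T_hat_D1[OF v1[unfolded e1]]
    by (rule prod_eqI; simp only: fst_conv snd_conv gr_simps; linarith)
  have v2: "T_hat (T_hat (U z)) \<in> D2"
    unfolding e2 D2_iff D_iff gr_simps by (insert I, intro conjI; linarith)
  show "T_hat (U z) \<in> D1 - U ` D" using v1 by (rule D1_outside_UD)
  show "T_hat (T_hat (U z)) \<in> D2 - U ` D" using v2 by (rule D2_outside_UD)
  show "T_hat (T_hat (T_hat (U z))) = U (T_hat z)"
    unfolding e2 T_hat_D2[OF v2[unfolded e2]]
    unfolding z T_hat_D2[OF assms[unfolded z]] U_eq
    by (rule prod_eqI; simp only: fst_conv snd_conv gr_simps; linarith)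
qed

lemma U_path_D3:
  assumes "z \<in> D3"
  shows "U z \<in> D0" "T_hat (U z) \<in> D1 - U ` D" "T_hat (T_hat (U z)) \<in> D1 - U ` D"
    "T_hat (T_hat (T_hat (U z))) \<in> D1 - U ` D"
    "T_hat (T_hat (T_hat (T_hat (U z)))) \<in> D2 - U ` D"
    "T_hat (T_hat (T_hat (T_hat (T_hat (U z))))) = U (T_hat z)"
proof -
  obtain x where z: "z = (x, 0)" using assms by (cases z) (auto simp: D3_iff)
  have d: "(x, 0) \<in> D" and h: "2 < x + gr" using assms by (auto simp: D3_iff_D z)
  note I = D_bounds[OF d, unfolded mult_zero_right] h h[THEN gr_scale, unfolded gr_simps]
  have u: "U z = (2 * x - gr * x, 0)" by (simp add: z U_eq)
  show v0: "U z \<in> D0"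
    unfolding u D0_iff D_iff gr_simps by (insert I, intro conjI; linarith)
  have e1: "T_hat (U z) = (gr - 1, 2 * x - gr * x)"
    unfolding u T_hat_D0[OF v0[unfolded u]]
    by (rule prod_eqI; simp only: fst_conv snd_conv gr_simps; linarith)
  have v1: "T_hat (U z) \<in> D1"
    unfolding e1 D1_iff D_iff gr_simps by (insert I, intro conjI; linarith)
  have e2: "T_hat (T_hat (U z)) = (2 * x - gr * x - 1 + gr, 2 - gr)"
    unfolding e1 T_hat_D1[OF v1[unfolded e1]]
    by (rule prod_eqI; simp only: fst_conv snd_conv gr_simps; linarith)
  have v2: "T_hat (T_hat (U z)) \<in> D1"
    unfolding e2 D1_iff D_iff gr_simps by (insert I, intro conjI; linarith)
  have e3: "T_hat (T_hat (T_hat (U z))) = (x - gr * x + 1, gr * x - 2 * x + 2 - gr)"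
    unfolding e2 T_hat_D1[OF v2[unfolded e2]]
    by (rule prod_eqI; simp only: fst_conv snd_conv gr_simps; linarith)
  have v3: "T_hat (T_hat (T_hat (U z))) \<in> D1"
    unfolding e3 D1_iff D_iff gr_simps by (insert I, intro conjI; linarith)
  have e4: "T_hat (T_hat (T_hat (T_hat (U z)))) = (gr * x - x + 2 - gr, gr * x - x)"
    unfolding e3 T_hat_D1[OF v3[unfolded e3]]
    by (rule prod_eqI; simp only: fst_conv snd_conv gr_simps; linarith)
  have v4: "T_hat (T_hat (T_hat (T_hat (U z)))) \<in> D2"
    unfolding e4 D2_iff D_iff gr_simps by (insert I, intro conjI; linarith)
  show "T_hat (U z) \<in> D1 - U ` D" using v1 by (rule D1_outside_UD)
  show "T_hat (T_hat (U z)) \<in> D1 - U ` D" using v2 by (rule D1_outside_UD)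
  show "T_hat (T_hat (T_hat (U z))) \<in> D1 - U ` D" using v3 by (rule D1_outside_UD)
  show "T_hat (T_hat (T_hat (T_hat (U z)))) \<in> D2 - U ` D" using v4 by (rule D2_outside_UD)
  show "T_hat (T_hat (T_hat (T_hat (T_hat (U z))))) = U (T_hat z)"
    unfolding e4 T_hat_D2[OF v4[unfolded e4]]
    unfolding z T_hat_D3[OF assms[unfolded z]] U_eq
    by (rule prod_eqI; simp only: fst_conv snd_conv gr_simps; linarith)
qed

definition level :: "nat \<Rightarrow> (real \<times> real) set" where
  "level n = (U ^^ n) ` D"

lemma UD_subset_D: "U ` D \<subseteq> D"
  using UD_subset D_pieces_subset by blast

lemma level_Suc: "level (Suc n) = (U ^^ n) ` (U ` D)"
  by (simp add: level_def image_comp funpow_swap1 funpow_Suc_right del: funpow.simps)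

lemma level_Suc_subset: "level (Suc n) \<subseteq> level n"
  unfolding level_Suc level_def[of n] using UD_subset_D by blast

lemma in_level_Suc_iff: "(U ^^ n) v \<in> level (Suc n) \<longleftrightarrow> v \<in> U ` D"
  unfolding level_Suc using inj_image_mem_iff[OF inj_fn[OF inj_U]] by blast

text \<open>The induction step follows \<open>U z\<close> through \<open>U_path_D0\<close>, \<dots>, \<open>U_path_D3\<close>, again from the last
  visit backwards, where the induction hypothesis supplies the time of each step of \<open>T_hat\<close>.\<close>

lemma level_return:
  assumes "z \<in> D"
  shows "first_return T (level n) ((U ^^ n) z) (level_time n z) ((U ^^ n) (T_hat z))"
  using assms
proof (induction n arbitrary: z)
  case 0
  then show ?case using first_return_T_hat by (simp add: level_def)
next
  case (Suc n)
  define visit where "visit v k \<longleftrightarrow>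
    first_return T (level (Suc n)) ((U ^^ n) v) k ((U ^^ n) (U (T_hat z)))" for v k
  have last: "visit v k" if "T_hat v = U (T_hat z)" "v \<in> D" "k = level_time n v" for v k
  proof -
    have "(U ^^ n) (T_hat v) \<in> level (Suc n)"
      using that(1) T_hat_in_D[OF Suc.prems] by (simp add: in_level_Suc_iff)
    then show ?thesis
      using first_return_subset[OF Suc.IH[OF that(2)] level_Suc_subset] that
      by (simp add: visit_def)
  qed
  have step: "visit v k"
    if "visit (T_hat v) m" "T_hat v \<notin> U ` D" "v \<in> D" "k = level_time n v + m" for v k m
  proof -
    have "(U ^^ n) (T_hat v) \<notin> level (Suc n)"
      using that(2) by (simp add: in_level_Suc_iff)
    then show ?thesis
      using first_return_trans[OF Suc.IH[OF that(3)] level_Suc_subset] that(1,4)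
      by (simp add: visit_def)
  qed
  note D = D_pieces_subset[THEN subsetD]
  have "visit (U z) (level_time (Suc n) z)"
    using Suc.prems
  proof (cases rule: D_cases)
    case D0
    note p = U_path_D0[OF D0]
    have "visit (T_hat (T_hat (U z))) (10 * repunit n + 6)"
      by (rule last) (use p D in \<open>auto simp: level_time_simps\<close>)
    then have "visit (T_hat (U z)) (30 * repunit n + 10)"
      by (rule step) (use p D in \<open>auto simp: level_time_simps\<close>)
    then have "visit (U z) (40 * repunit n + 16)"
      by (rule step) (use p D in \<open>auto simp: level_time_simps\<close>)
    moreover have "level_time (Suc n) z = 40 * repunit n + 16"
      using D0 by (simp add: level_time_simps)
    ultimately show ?thesis by simp
  next
    case D1
    note p = U_path_D1[OF D1]
    have "visit (T_hat (T_hat (T_hat (T_hat (U z))))) (10 * repunit n + 6)"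
      by (rule last) (use p D in \<open>auto simp: level_time_simps\<close>)
    then have "visit (T_hat (T_hat (T_hat (U z)))) (30 * repunit n + 10)"
      by (rule step) (use p D in \<open>auto simp: level_time_simps\<close>)
    then have "visit (T_hat (T_hat (U z))) (50 * repunit n + 14)"
      by (rule step) (use p D in \<open>auto simp: level_time_simps\<close>)
    then have "visit (T_hat (U z)) (70 * repunit n + 18)"
      by (rule step) (use p D in \<open>auto simp: level_time_simps\<close>)
    then have "visit (U z) (80 * repunit n + 24)"
      by (rule step) (use p D in \<open>auto simp: level_time_simps\<close>)
    moreover have "level_time (Suc n) z = 80 * repunit n + 24"
      using D1 by (simp add: level_time_simps)
    ultimately show ?thesis by simp
  next
    case D2
    note p = U_path_D2[OF D2]
    have "visit (T_hat (T_hat (U z))) (10 * repunit n + 7)"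
      by (rule last) (use p D in \<open>auto simp: level_time_simps\<close>)
    then have "visit (T_hat (U z)) (30 * repunit n + 11)"
      by (rule step) (use p D in \<open>auto simp: level_time_simps\<close>)
    then have "visit (U z) (40 * repunit n + 17)"
      by (rule step) (use p D in \<open>auto simp: level_time_simps\<close>)
    moreover have "level_time (Suc n) z = 40 * repunit n + 17"
      using D2 by (simp add: level_time_simps)
    ultimately show ?thesis by simp
  next
    case D3
    note p = U_path_D3[OF D3]
    have "visit (T_hat (T_hat (T_hat (T_hat (U z))))) (10 * repunit n + 7)"
      by (rule last) (use p D in \<open>auto simp: level_time_simps\<close>)
    then have "visit (T_hat (T_hat (T_hat (U z)))) (30 * repunit n + 11)"
      by (rule step) (use p D in \<open>auto simp: level_time_simps\<close>)
    then have "visit (T_hat (T_hat (U z))) (50 * repunit n + 15)"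
      by (rule step) (use p D in \<open>auto simp: level_time_simps\<close>)
    then have "visit (T_hat (U z)) (70 * repunit n + 19)"
      by (rule step) (use p D in \<open>auto simp: level_time_simps\<close>)
    then have "visit (U z) (80 * repunit n + 25)"
      by (rule step) (use p D in \<open>auto simp: level_time_simps\<close>)
    moreover have "level_time (Suc n) z = 80 * repunit n + 25"
      using D3 by (simp add: level_time_simps)
    ultimately show ?thesis by simp
  qed
  then show ?case
    by (simp add: visit_def funpow_swap1)
qed

section \<open>Orbits and periods\<close>

lemma T_in_unit_square: "z \<in> unit_square \<Longrightarrow> T z \<in> unit_square"
  by (cases z) (auto simp: T_def unit_square_def frac_lt_1)

lemma inj_on_T: "inj_on T unit_square"
proof (rule inj_onI)
  fix z w :: "real \<times> real"
  assume sq: "z \<in> unit_square" "w \<in> unit_square" and eq: "T z = T w"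
  obtain x y x' y' where z: "z = (x, y)" and w: "w = (x', y')" by force
  have y: "y' = y" and fr: "frac (- x + gr * y) = frac (- x' + gr * y)"
    using eq by (auto simp: z w T_def)
  have "x - x' \<in> \<int>"
  proof -
    have "x - x' = of_int (\<lfloor>- x' + gr * y\<rfloor> - \<lfloor>- x + gr * y\<rfloor>)"
      using fr unfolding frac_def by simp
    then show ?thesis by (metis Ints_of_int)
  qed
  moreover have "\<bar>x - x'\<bar> < 1"
    using sq by (auto simp: z w unit_square_def)
  ultimately show "z = w"
    using y by (auto simp: z w dest: Ints_nonzero_abs_less1)
qed

lemma T_pow_in_unit_square: "z \<in> unit_square \<Longrightarrow> (T ^^ k) z \<in> unit_square"
  by (induction k) (auto simp: T_in_unit_square)

lemma period_T:
  assumes "z \<in> unit_square"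
  shows "period (T z) = period z"
proof -
  have "(T ^^ p) (T z) = T z \<longleftrightarrow> (T ^^ p) z = z" for p
    unfolding funpow_swap1[symmetric]
    by (rule inj_on_eq_iff[OF inj_on_T T_pow_in_unit_square[OF assms] assms])
  then show ?thesis unfolding period_def by simp
qed

lemma period_T_pow:
  "z \<in> unit_square \<Longrightarrow> period ((T ^^ k) z) = period z"
  by (induction k) (auto simp: period_T T_pow_in_unit_square)

text \<open>Two points are related when their forward orbits meet. As \<open>T\<close> is injective on the square, this
  says there that the points lie on a common two-sided orbit.\<close>

definition same_orbit :: "real \<times> real \<Rightarrow> real \<times> real \<Rightarrow> bool" where
  "same_orbit z w \<longleftrightarrow> (\<exists>a b. (T ^^ a) z = (T ^^ b) w)"

lemma same_orbitI: "(T ^^ a) z = w \<Longrightarrow> same_orbit z w"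
  unfolding same_orbit_def by (rule exI[of _ a], rule exI[of _ 0]) simp

lemma same_orbit_sym: "same_orbit z w \<Longrightarrow> same_orbit w z"
  unfolding same_orbit_def by metis

lemma same_orbit_trans:
  assumes "same_orbit z w" "same_orbit w v"
  shows "same_orbit z v"
proof -
  obtain a b c d where ab: "(T ^^ a) z = (T ^^ b) w" and cd: "(T ^^ c) w = (T ^^ d) v"
    using assms by (auto simp: same_orbit_def)
  have "(T ^^ (c + a)) z = (T ^^ (c + b)) w"
    using ab by (simp add: funpow_add)
  also have "\<dots> = (T ^^ (b + d)) v"
    using cd by (simp add: add.commute[of c] funpow_add)
  finally have "(T ^^ (c + a)) z = (T ^^ (b + d)) v" .
  then show ?thesis unfolding same_orbit_def by blast
qed

lemma period_same_orbit:
  assumes "same_orbit z w" "z \<in> unit_square" "w \<in> unit_square"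
  shows "period z = period w"
proof -
  obtain a b where "(T ^^ a) z = (T ^^ b) w" using assms(1) by (auto simp: same_orbit_def)
  then show ?thesis
    using period_T_pow[OF assms(2), of a] period_T_pow[OF assms(3), of b] by simp
qed

lemma period_first_return:
  assumes "first_return T {z} z n z"
  shows "period z = enat n"
proof -
  have n: "1 \<le> n" "(T ^^ n) z = z" and min: "\<And>k. 0 < k \<Longrightarrow> k < n \<Longrightarrow> (T ^^ k) z \<noteq> z"
    using assms by (auto simp: first_return_def)
  have "(LEAST p. 1 \<le> p \<and> (T ^^ p) z = z) = n"
  proof (rule Least_equality)
    show "n \<le> p" if "1 \<le> p \<and> (T ^^ p) z = z" for p
      using that min[of p] by linarith
  qed (use n in simp)
  moreover have "\<exists>p\<ge>1. (T ^^ p) z = z" using n by blast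
  ultimately show ?thesis unfolding period_def by simp
qed

lemma T_hat_pow_in_D: "z \<in> D \<Longrightarrow> (T_hat ^^ k) z \<in> D"
  by (induction k) (auto simp: T_hat_in_D)

lemma in_level: "z \<in> D \<Longrightarrow> (U ^^ n) z \<in> level n"
  by (simp add: level_def)

lemma level_subset_D: "level n \<subseteq> D"
proof (induction n)
  case (Suc n)
  then show ?case using level_Suc_subset by blast
qed (simp add: level_def)

lemma level_subset_unit_square: "level n \<subseteq> unit_square"
  using level_subset_D D_subset_unit_square by blast

text \<open>The first return to the single point \<open>(U ^^ n) z\<close> is the last of the \<open>q\<close> returns to the level.\<close>

lemma period_level:
  assumes z: "z \<in> D" and "0 < q" and cyc: "(T_hat ^^ q) z = z"
    and min: "\<And>j. 0 < j \<Longrightarrow> j < q \<Longrightarrow> (T_hat ^^ j) z \<noteq> z"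
  shows "period ((U ^^ n) z) = enat (\<Sum>j<q. level_time n ((T_hat ^^ j) z))"
proof -
  let ?e = "(U ^^ n) z" and ?f = "\<lambda>j. level_time n ((T_hat ^^ j) z)"
  have sub: "{?e} \<subseteq> level n" using in_level[OF z] by blast
  have "first_return T {?e} ((U ^^ n) ((T_hat ^^ i) z)) (sum ?f {i..<q}) ?e" if "i < q" for i
    using \<open>i < q\<close>
    \<comment> \<open>downwards, from the last point of the cycle\<close>
  proof (induction rule: strict_inc_induct)
    case (base i)
    then have "T_hat ((T_hat ^^ i) z) = z" using cyc by simp
    moreover have "sum ?f {i..<q} = ?f i" using base by simp
    ultimately show ?case
      using level_return[OF T_hat_pow_in_D[OF z], of n i] sub
      by (auto intro: first_return_subset)
  next
    case (step i)
    have ne: "(U ^^ n) ((T_hat ^^ Suc i) z) \<noteq> ?e"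
    proof
      assume "(U ^^ n) ((T_hat ^^ Suc i) z) = ?e"
      then have "(T_hat ^^ Suc i) z = z" by (rule injD[OF inj_fn[OF inj_U]])
      then show False using min[of "Suc i"] step.hyps by simp
    qed
    have "sum ?f {i..<q} = ?f i + sum ?f {Suc i..<q}"
      using step.hyps by (simp add: sum.atLeast_Suc_lessThan)
    moreover have "first_return T {?e} ((U ^^ n) ((T_hat ^^ i) z)) (?f i + sum ?f {Suc i..<q}) ?e"
      by (rule first_return_trans[OF level_return[OF T_hat_pow_in_D[OF z]] sub])
        (use ne step.IH in auto)
    ultimately show ?case by simp
  qed
  from this[OF \<open>0 < q\<close>] show ?thesis
    by (simp add: period_first_return lessThan_atLeast0)
qed

section \<open>Two-sided iteration and the map \<open>S\<close>\<close>

text \<open>If two points had the same return, after \<open>n \<le> m\<close> steps, injectivity of \<open>T\<close> would put the first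
  one on the path of the second, where an earlier visit to \<open>D\<close> is impossible unless \<open>n = m\<close>.\<close>

lemma inj_on_T_hat: "inj_on T_hat D"
proof -
  have aux: "z = w"
    if "z \<in> D" "w \<in> D" "first_return T D z n v" "first_return T D w m v" "n \<le> m" for z w v n m
  proof -
    have sq: "z \<in> unit_square" "w \<in> unit_square" using that D_subset_unit_square by auto
    have inj: "inj_on (T ^^ n) unit_square"
      by (induction n) (auto simp: inj_on_def T_pow_in_unit_square dest!: inj_onD[OF inj_on_T])
    have "(T ^^ n) z = (T ^^ (n + (m - n))) w"
      using that by (simp add: first_return_def)
    then have "(T ^^ n) z = (T ^^ n) ((T ^^ (m - n)) w)"
      by (simp add: funpow_add)
    then have "z = (T ^^ (m - n)) w"
      using inj_onD[OF inj] sq T_pow_in_unit_square by blast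
    moreover have "m - n = 0"
    proof (rule ccontr)
      assume "m - n \<noteq> 0"
      then have "(T ^^ (m - n)) w \<notin> D"
        using that by (simp add: first_return_def)
      then show False using calculation that(1) by simp
    qed
    ultimately show ?thesis by simp
  qed
  show ?thesis
  proof (rule inj_onI)
    fix z w
    assume "z \<in> D" "w \<in> D" "T_hat z = T_hat w"
    then show "z = w"
      using aux[of z w] aux[of w z] first_return_T_hat[of z] first_return_T_hat[of w]
      by (metis nle_le)
  qed
qed

text \<open>The images of \<open>D0\<close> and \<open>D1\<close> are the parts of \<open>D\<close> above the base to the left and to the right of
  \<open>u = 1 / gr\<close>, where the left part includes the line; those of \<open>D2\<close> and \<open>D3\<close> are the two parts of
  the base.\<close>

lemma T_hat_surj:
  assumes "w \<in> D"
  shows "w \<in> T_hat ` D"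
proof -
  obtain u v where w: "w = (u, v)" by force
  then have d: "(u, v) \<in> D" using assms by simp
  note I = D_bounds[OF d]
  consider (0) "0 < v" "u + 1 \<le> gr" | (1) "0 < v" "gr < u + 1" | (2) "v = 0" "u + gr \<le> 2"
    | (3) "v = 0" "2 < u + gr"
    using I by linarith
  then show ?thesis
  proof cases
    case 0
    note J = 0(1) gr_scale[OF 0(1), unfolded gr_simps] 0(2) gr_scale_le[OF 0(2), unfolded gr_simps]
    have a: "(v + 1 - gr * u, gr - 1 - u) \<in> D0"
      unfolding D0_iff D_iff gr_simps by (insert I J, intro conjI; linarith)
    moreover have "T_hat (v + 1 - gr * u, gr - 1 - u) = w"
      unfolding T_hat_D0[OF a] w by (rule prod_eqI; simp only: fst_conv snd_conv gr_simps; linarith)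
    ultimately show ?thesis using D_pieces_subset by blast
  next
    case 1
    note J = 1(1) gr_scale[OF 1(1), unfolded gr_simps] 1(2) gr_scale[OF 1(2), unfolded gr_simps]
    have a: "(1 - v, u - gr * v) \<in> D1"
      unfolding D1_iff D_iff gr_simps by (insert I J, intro conjI; linarith)
    moreover have "T_hat (1 - v, u - gr * v) = w"
      unfolding T_hat_D1[OF a] w by (rule prod_eqI; simp only: fst_conv snd_conv gr_simps; linarith)
    ultimately show ?thesis using D_pieces_subset by blast
  next
    case 2
    note J = 2(2) gr_scale_le[OF 2(2), unfolded gr_simps] I[unfolded 2(1) mult_zero_right]
    have a: "(1 - gr * u, gr - 1 - gr * u) \<in> D2"
      unfolding D2_iff D_iff gr_simps by (insert J, intro conjI; linarith)
    moreover have "T_hat (1 - gr * u, gr - 1 - gr * u) = w"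
      unfolding T_hat_D2[OF a] w 2(1) by (rule prod_eqI; simp only: fst_conv snd_conv gr_simps; linarith)
    ultimately show ?thesis using D_pieces_subset by blast
  next
    case 3
    note J = 3(2) gr_scale[OF 3(2), unfolded gr_simps] I[unfolded 3(1) mult_zero_right]
    have a: "(1 - u, 0) \<in> D3"
      unfolding D3_iff by (insert J, intro conjI; (rule refl | linarith))
    moreover have "T_hat (1 - u, 0) = w"
      unfolding T_hat_D3[OF a] w 3(1) by simp
    ultimately show ?thesis using D_pieces_subset by blast
  qed
qed

lemma inv_T_hat_in_D: "z \<in> D \<Longrightarrow> inv_into D T_hat z \<in> D"
  using T_hat_surj by (rule inv_into_into)

lemma T_hat_inv_T_hat: "z \<in> D \<Longrightarrow> T_hat (inv_into D T_hat z) = z"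
  using T_hat_surj by (rule f_inv_into_f)

lemma same_orbit_refl: "same_orbit z z"
  by (rule same_orbitI[of 0]) simp

lemma same_orbit_level:
  assumes "z \<in> D"
  shows "same_orbit ((U ^^ n) z) ((U ^^ n) (T_hat z))"
  using level_return[OF assms, of n] by (auto simp: first_return_def intro: same_orbitI)

lemma same_orbit_level_iter:
  assumes z: "z \<in> D"
  shows "same_orbit ((U ^^ n) z) ((U ^^ n) (T_hat_iter k z))"
proof -
  let ?J = "inv_into D T_hat"
  have "same_orbit ((U ^^ n) z) ((U ^^ n) ((T_hat ^^ j) z))" for j
    by (induction j)
      (auto intro: same_orbit_refl same_orbit_trans same_orbit_level[OF T_hat_pow_in_D[OF z]])
  moreover have "(?J ^^ j) z \<in> D \<and> same_orbit ((U ^^ n) z) ((U ^^ n) ((?J ^^ j) z))" for j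
  proof (induction j)
    case (Suc j)
    let ?v = "(?J ^^ j) z"
    have "same_orbit ((U ^^ n) (?J ?v)) ((U ^^ n) ?v)"
      using same_orbit_level[OF inv_T_hat_in_D, of ?v n] Suc by (simp add: T_hat_inv_T_hat)
    then have "same_orbit ((U ^^ n) z) ((U ^^ n) (?J ?v))"
      using Suc same_orbit_trans[OF _ same_orbit_sym] by blast
    then show ?case
      using Suc by (simp add: inv_T_hat_in_D)
  qed (simp add: z same_orbit_refl)
  ultimately show ?thesis by (simp add: T_hat_iter_def)
qed

lemma inv_U_U: "inv U (U z) = z"
  by (rule inv_f_f[OF inj_U])

text \<open>The choice of \<open>s\<close> matters only through the fact that \<open>S\<close> moves along the \<open>T_hat\<close>-orbit into
  \<open>U ` D\<close>, which at level \<open>n\<close> is a move along the orbit of \<open>T\<close>.\<close>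

lemma SR_same_orbit:
  assumes s: "hit_choice s"
  shows "SR s n z = Some w \<Longrightarrow> w \<in> D \<and> z \<in> unit_square \<and> same_orbit z ((U ^^ n) w)"
proof (induction n arbitrary: w)
  case 0
  then have z: "z \<in> unit_square - Rset" and w: "w = R z" by (auto split: if_splits)
  then obtain m where "(T ^^ m) z \<in> D" by (auto simp: Rset_def)
  then have "R z \<in> D" unfolding R_def by (rule LeastI)
  moreover have "same_orbit z (R z)" unfolding R_def by (rule same_orbitI) (rule refl)
  ultimately show ?case using z w by simp
next
  case (Suc n)
  then obtain v where v: "SR s n z = Some v" "v \<in> D - P" "w = S s v"
    by (auto split: option.splits if_splits)
  have "T_hat_iter (s v) v \<in> U ` D" using s v(2) by (simp add: hit_choice_def)
  then have w: "w \<in> D" "U w = T_hat_iter (s v) v"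
    unfolding v(3) S_def by (auto simp: inv_U_U)
  have "same_orbit z ((U ^^ n) v)" "z \<in> unit_square" using Suc.IH[OF v(1)] by auto
  moreover have "same_orbit ((U ^^ n) v) ((U ^^ Suc n) w)"
    using same_orbit_level_iter[of v n "s v"] v(2) w by (simp add: funpow_swap1)
  ultimately show ?case using w same_orbit_trans by blast
qed

lemma SR_period:
  assumes "hit_choice s" "SR s n z = Some w"
  shows "period z = period ((U ^^ n) w)"
proof -
  have "w \<in> D" "z \<in> unit_square" "same_orbit z ((U ^^ n) w)"
    using SR_same_orbit[OF assms] by auto
  moreover have "(U ^^ n) w \<in> unit_square"
    using in_level[OF \<open>w \<in> D\<close>] level_subset_unit_square by blast
  ultimately show ?thesis by (intro period_same_orbit)
qed

section \<open>The cycles of the return map and their periods\<close>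

lemma funpow_gcd:
  "(f ^^ a) z = z \<Longrightarrow> (f ^^ b) z = z \<Longrightarrow> (f ^^ gcd a b) z = z"
proof (induction a b rule: gcd_nat_induct)
  case (step a b)
  have "(f ^^ (a mod b)) z = z"
    using funpow_mod_eq[OF step.prems(2), of a] step.prems by simp
  with step show ?case by (simp add: gcd_red_nat[of a b])
qed simp

lemma period_level_fixed:
  assumes "z \<in> D" "T_hat z = z"
  shows "period ((U ^^ n) z) = enat (level_time n z)"
  using period_level[of z 1 n] assms by simp

lemma period_level_5:
  assumes "z \<in> D" "(T_hat ^^ 5) z = z" "T_hat z \<noteq> z"
  shows "period ((U ^^ n) z) = enat (\<Sum>j<5. level_time n ((T_hat ^^ j) z))"
proof (rule period_level)
  fix j :: nat
  assume j: "0 < j" "j < 5"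
  show "(T_hat ^^ j) z \<noteq> z"
  proof
    assume "(T_hat ^^ j) z = z"
    then have "(T_hat ^^ gcd j 5) z = z" using assms(2) by (rule funpow_gcd)
    moreover have "gcd j 5 = 1"
    proof -
      have "j = 1 \<or> j = 2 \<or> j = 3 \<or> j = 4" using j by linarith
      then show ?thesis by (auto simp: gcd_non_0_nat)
    qed
    ultimately show False using assms(3) by simp
  qed
qed (use assms in auto)

lemma funpow_5: "(f ^^ 5) z = f (f (f (f (f z))))"
  by (simp add: numeral_eq_Suc)

text \<open>On \<open>D0\<close> the map is a rotation of order 5, so that an orbit that stays in \<open>D0\<close> closes after five
  steps. The same holds for \<open>D1\<close>.\<close>

lemma T_hat_pow_5_D0:
  assumes "\<And>j. (T_hat ^^ j) z \<in> D0"
  shows "(T_hat ^^ 5) z = z"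
proof -
  obtain x y where z: "z = (x, y)" by force
  note a = assms[of 0] assms[of "Suc 0"] assms[of "Suc (Suc 0)"] assms[of "Suc (Suc (Suc 0))"]
    assms[of "Suc (Suc (Suc (Suc 0)))"]
  note a = a[unfolded funpow.simps id_apply o_apply z]
  have 1: "T_hat (x, y) = (gr - 1 - y, x - gr * y)"
    using a(1) by (rule T_hat_D0)
  have 2: "T_hat (T_hat (x, y)) = (gr - 1 - x + gr * y, gr - 1 - gr * x + gr * y)"
    unfolding 1 T_hat_D0[OF a(2)[unfolded 1]]
    by (rule prod_eqI; simp only: fst_conv snd_conv gr_simps; linarith)
  have 3: "T_hat (T_hat (T_hat (x, y))) = (gr * x - gr * y, gr - 2 + gr * x - y)"
    unfolding 2 T_hat_D0[OF a(3)[unfolded 2]]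
    by (rule prod_eqI; simp only: fst_conv snd_conv gr_simps; linarith)
  have 4: "T_hat (T_hat (T_hat (T_hat (x, y)))) = (1 - gr * x + y, gr - 1 - x)"
    unfolding 3 T_hat_D0[OF a(4)[unfolded 3]]
    by (rule prod_eqI; simp only: fst_conv snd_conv gr_simps; linarith)
  show ?thesis
    unfolding funpow_5 z 4 T_hat_D0[OF a(5)[unfolded 4]]
    by (rule prod_eqI; simp only: fst_conv snd_conv gr_simps; linarith)
qed

lemma T_hat_pow_5_D1:
  assumes "\<And>j. (T_hat ^^ j) z \<in> D1"
  shows "(T_hat ^^ 5) z = z"
proof -
  obtain x y where z: "z = (x, y)" by force
  note a = assms[of 0] assms[of "Suc 0"] assms[of "Suc (Suc 0)"] assms[of "Suc (Suc (Suc 0))"]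
    assms[of "Suc (Suc (Suc (Suc 0)))"]
  note a = a[unfolded funpow.simps id_apply o_apply z]
  have 1: "T_hat (x, y) = (gr - gr * x + y, 1 - x)"
    using a(1) by (rule T_hat_D1)
  have 2: "T_hat (T_hat (x, y)) = (gr * x - gr * y, 1 - gr + gr * x - y)"
    unfolding 1 T_hat_D1[OF a(2)[unfolded 1]]
    by (rule prod_eqI; simp only: fst_conv snd_conv gr_simps; linarith)
  have 3: "T_hat (T_hat (T_hat (x, y))) = (1 - x + gr * y, 1 - gr * x + gr * y)"
    unfolding 2 T_hat_D1[OF a(3)[unfolded 2]]
    by (rule prod_eqI; simp only: fst_conv snd_conv gr_simps; linarith)
  have 4: "T_hat (T_hat (T_hat (T_hat (x, y)))) = (1 - y, x - gr * y)"
    unfolding 3 T_hat_D1[OF a(4)[unfolded 3]]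
    by (rule prod_eqI; simp only: fst_conv snd_conv gr_simps; linarith)
  show ?thesis
    unfolding funpow_5 z 4 T_hat_D1[OF a(5)[unfolded 4]]
    by (rule prod_eqI; simp only: fst_conv snd_conv gr_simps; linarith)
qed

text \<open>The number \<open>gr ^ 2 + 1 = gr + 2\<close> has norm 5 and conjugate \<open>3 - gr\<close>.\<close>

lemma divide_gr_sq_plus_1: "a / (gr ^ 2 + 1) = a * (3 - gr) / 5"
proof -
  have "gr ^ 2 + 1 = gr + 2" "gr + 2 \<noteq> 0"
    using gr_gt_1 by (simp_all add: power2_eq_square gr_gr)
  then show ?thesis
    by (simp add: field_simps gr_gr_left gr_gr)
qed

lemma c_alpha_eq: "c_alpha = ((2 * gr - 1) / 5, (3 * gr - 4) / 5)"
  unfolding c_alpha_def gr_inverse divide_gr_sq_plus_1 by (simp add: algebra_simps gr_gr)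

lemma c_beta_eq: "c_beta = ((gr + 2) / 5, (3 - gr) / 5)"
  unfolding c_beta_def divide_gr_sq_plus_1 by (simp add: algebra_simps gr_gr power2_eq_square)

lemma c_alpha_in_D0: "c_alpha \<in> D0"
  unfolding c_alpha_eq D0_iff D_iff times_divide_eq_right gr_simps
    add_divide_distrib diff_divide_distrib
  by (insert gr_bounds, intro conjI; linarith)

lemma c_beta_in_D1: "c_beta \<in> D1"
  unfolding c_beta_eq D1_iff D_iff times_divide_eq_right gr_simps
    add_divide_distrib diff_divide_distrib
  by (insert gr_bounds, intro conjI; linarith)

lemma T_hat_fixed_D0_iff:
  assumes "z \<in> D0"
  shows "T_hat z = z \<longleftrightarrow> z = c_alpha"
proof -
  obtain x y where z: "z = (x, y)" by force
  have "T_hat z = z \<longleftrightarrow> gr - 1 - y = x \<and> x - gr * y = y"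
    using assms by (simp add: z T_hat_D0)
  also have "\<dots> \<longleftrightarrow> 5 * x = 2 * gr - 1 \<and> 5 * y = 3 * gr - 4"
  proof
    assume "gr - 1 - y = x \<and> x - gr * y = y"
    then have e: "gr - 1 - y = x" "x - gr * y = y" by simp_all
    have "gr * (gr - 1 - y) = gr * x" "gr * (x - gr * y) = gr * y" using e by simp_all
    then have "5 * x = 2 * gr - 1" "5 * y = 3 * gr - 4"
      using e unfolding gr_simps by linarith+
    then show "5 * x = 2 * gr - 1 \<and> 5 * y = 3 * gr - 4" ..
  next
    assume "5 * x = 2 * gr - 1 \<and> 5 * y = 3 * gr - 4"
    then have e: "5 * x = 2 * gr - 1" "5 * y = 3 * gr - 4" by simp_all
    have "gr * (5 * y) = gr * (3 * gr - 4)" using e by simp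
    then have "gr - 1 - y = x" "x - gr * y = y"
      using e unfolding gr_simps by linarith+
    then show "gr - 1 - y = x \<and> x - gr * y = y" ..
  qed
  also have "\<dots> \<longleftrightarrow> z = c_alpha"
    unfolding z c_alpha_eq by (auto simp: field_simps)
  finally show ?thesis .
qed

lemma T_hat_fixed_D1_iff:
  assumes "z \<in> D1"
  shows "T_hat z = z \<longleftrightarrow> z = c_beta"
proof -
  obtain x y where z: "z = (x, y)" by force
  have "T_hat z = z \<longleftrightarrow> gr - gr * x + y = x \<and> 1 - x = y"
    using assms by (simp add: z T_hat_D1)
  also have "\<dots> \<longleftrightarrow> 5 * x = gr + 2 \<and> 5 * y = 3 - gr"
  proof
    assume "gr - gr * x + y = x \<and> 1 - x = y"
    then have e: "gr - gr * x + y = x" "1 - x = y" by simp_all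
    have "gr * (gr - gr * x + y) = gr * x" "gr * (1 - x) = gr * y" using e by simp_all
    then have "5 * x = gr + 2" "5 * y = 3 - gr"
      using e unfolding gr_simps by linarith+
    then show "5 * x = gr + 2 \<and> 5 * y = 3 - gr" ..
  next
    assume "5 * x = gr + 2 \<and> 5 * y = 3 - gr"
    then have e: "5 * x = gr + 2" "5 * y = 3 - gr" by simp_all
    have "gr * (5 * x) = gr * (gr + 2)" using e by simp
    then have "gr - gr * x + y = x" "1 - x = y"
      using e unfolding gr_simps by linarith+
    then show "gr - gr * x + y = x \<and> 1 - x = y" ..
  qed
  also have "\<dots> \<longleftrightarrow> z = c_beta"
    unfolding z c_beta_eq by (auto simp: field_simps)
  finally show ?thesis .
qed

lemma D_alpha_pow: "z \<in> D_alpha \<Longrightarrow> (T_hat ^^ j) z \<in> D0"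
  unfolding D_alpha_def T_hat_iter_def by (auto dest: spec[of _ "int j"])

lemma D_beta_pow: "z \<in> D_beta \<Longrightarrow> (T_hat ^^ j) z \<in> D1"
  unfolding D_beta_def T_hat_iter_def by (auto dest: spec[of _ "int j"])

lemma period_c_alpha: "period ((U ^^ n) c_alpha) = enat (10 * repunit n + 6)"
  using period_level_fixed[of c_alpha n] c_alpha_in_D0 T_hat_fixed_D0_iff D_pieces_subset
  by (auto simp: level_time_simps)

lemma period_c_beta: "period ((U ^^ n) c_beta) = enat (20 * repunit n + 4)"
  using period_level_fixed[of c_beta n] c_beta_in_D1 T_hat_fixed_D1_iff D_pieces_subset
  by (auto simp: level_time_simps)

lemma period_D_alpha:
  assumes "z \<in> D_alpha" "z \<noteq> c_alpha"
  shows "period ((U ^^ n) z) = enat (50 * repunit n + 30)"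
proof -
  have p: "(T_hat ^^ j) z \<in> D0" for j using D_alpha_pow[OF assms(1)] .
  have "z \<in> D0" using p[of 0] by simp
  then have "z \<in> D" "T_hat z \<noteq> z"
    using assms T_hat_fixed_D0_iff D_pieces_subset by auto
  then show ?thesis
    using period_level_5 T_hat_pow_5_D0 p by (simp add: level_time_simps)
qed

lemma period_D_beta:
  assumes "z \<in> D_beta" "z \<noteq> c_beta"
  shows "period ((U ^^ n) z) = enat (100 * repunit n + 20)"
proof -
  have p: "(T_hat ^^ j) z \<in> D1" for j using D_beta_pow[OF assms(1)] .
  have "z \<in> D1" using p[of 0] by simp
  then have "z \<in> D" "T_hat z \<noteq> z"
    using assms T_hat_fixed_D1_iff D_pieces_subset by auto
  then show ?thesis
    using period_level_5 T_hat_pow_5_D1 p by (simp add: level_time_simps)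
qed

lemma period_half: "period ((U ^^ n) (1 / 2, 0)) = enat (20 * repunit n + 5)"
proof -
  have "(1 / 2, 0) \<in> D3" using gr_bounds by (simp add: D3_iff)
  then show ?thesis
    using period_level_fixed[of "(1 / 2, 0)" n] T_hat_D3 D_pieces_subset
    by (auto simp: level_time_simps)
qed

lemma period_D3:
  assumes "z \<in> D3" "z \<noteq> (1 / 2, 0)"
  shows "period ((U ^^ n) z) = enat (40 * repunit n + 10)"
proof -
  obtain x where z: "z = (x, 0)" and x: "2 < x + gr" "x + 1 < gr"
    using assms(1) by (cases z) (auto simp: D3_iff)
  have m: "(1 - x, 0) \<in> D3" using x by (simp add: D3_iff)
  have e: "T_hat z = (1 - x, 0)" "T_hat (1 - x, 0) = z"
    using T_hat_D3[of x] T_hat_D3[OF m] assms(1) z by auto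
  have ne: "(1 - x, 0) \<noteq> z" using assms(2) z by auto
  have "period ((U ^^ n) z) = enat (\<Sum>j<2. level_time n ((T_hat ^^ j) z))"
  proof (rule period_level)
    show "(T_hat ^^ j) z \<noteq> z" if "0 < j" "j < 2" for j
      using that ne e by (auto simp: less_Suc_eq numeral_2_eq_2)
  qed (use assms D_pieces_subset e in \<open>auto simp: numeral_2_eq_2\<close>)
  also have "(\<Sum>j<2. level_time n ((T_hat ^^ j) z)) = 40 * repunit n + 10"
    using e m assms(1) by (simp add: numeral_2_eq_2 level_time_simps)
  finally show ?thesis .
qed

text \<open>The cycle of a point of \<open>D_zeta\<close>: three visits to \<open>D0\<close> and one to \<open>D2\<close> lead back to \<open>D_zeta\<close>,
  reflected at its midpoint \<open>(gr - 1) / 2 = 1 / (2 * gr)\<close>.\<close>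

lemma zeta_path:
  assumes "2 * gr < x + 3" "x + gr < 2"
  shows "(x, 0) \<in> D0" "T_hat (x, 0) = (gr - 1, x)" "(gr - 1, x) \<in> D0"
    "T_hat (gr - 1, x) = (gr - 1 - x, gr - 1 - gr * x)" "(gr - 1 - x, gr - 1 - gr * x) \<in> D0"
    "T_hat (gr - 1 - x, gr - 1 - gr * x) = (gr * x, gr * x + gr - 2)"
    "(gr * x, gr * x + gr - 2) \<in> D2"
    "T_hat (gr * x, gr * x + gr - 2) = (gr - 1 - x, 0)"
proof -
  note I = assms gr_bounds assms[THEN gr_scale, unfolded gr_simps]
  show 0: "(x, 0) \<in> D0"
    unfolding D0_iff D_iff gr_simps by (insert I, intro conjI; linarith)
  show 1: "(gr - 1, x) \<in> D0"
    unfolding D0_iff D_iff gr_simps by (insert I, intro conjI; linarith)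
  show 2: "(gr - 1 - x, gr - 1 - gr * x) \<in> D0"
    unfolding D0_iff D_iff gr_simps by (insert I, intro conjI; linarith)
  show 3: "(gr * x, gr * x + gr - 2) \<in> D2"
    unfolding D2_iff D_iff gr_simps by (insert I, intro conjI; linarith)
  show "T_hat (x, 0) = (gr - 1, x)"
    unfolding T_hat_D0[OF 0] by simp
  show "T_hat (gr - 1, x) = (gr - 1 - x, gr - 1 - gr * x)"
    unfolding T_hat_D0[OF 1] by simp
  show "T_hat (gr - 1 - x, gr - 1 - gr * x) = (gr * x, gr * x + gr - 2)"
    unfolding T_hat_D0[OF 2] by (rule prod_eqI; simp only: fst_conv snd_conv gr_simps; linarith)
  show "T_hat (gr * x, gr * x + gr - 2) = (gr - 1 - x, 0)"
    unfolding T_hat_D2[OF 3] by (rule prod_eqI; simp only: fst_conv snd_conv gr_simps; linarith)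
qed

lemma D_zeta_iff: "(x, y) \<in> D_zeta \<longleftrightarrow> y = 0 \<and> 2 * gr < x + 3 \<and> x + gr < 2"
  unfolding D_zeta_def gr_inverse2 gr_inverse3 by auto

lemma D_zeta_center_eq: "1 / (2 * gr) = (gr - 1) / 2"
  using gr_inverse by (simp add: field_simps)

lemma D_zeta_center: "((gr - 1) / 2, 0) \<in> D_zeta"
  using gr_bounds by (simp add: D_zeta_iff field_simps)

lemma T_hat_pow_4_D_zeta:
  assumes "(x, 0) \<in> D_zeta"
  shows "(T_hat ^^ 4) (x, 0) = (gr - 1 - x, 0)" "(gr - 1 - x, 0) \<in> D_zeta"
    "(\<Sum>j<4. level_time n ((T_hat ^^ j) (x, 0))) = 40 * repunit n + 25"
  using assms zeta_path[of x] by (auto simp: D_zeta_iff numeral_eq_Suc level_time_simps)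

lemma D_zeta_subset: "D_zeta \<subseteq> D"
  using zeta_path(1) D_pieces_subset by (auto simp: D_zeta_iff)

lemma period_D_zeta_center:
  "period ((U ^^ n) (1 / (2 * gr), 0)) = enat (40 * repunit n + 25)"
proof -
  note p = T_hat_pow_4_D_zeta[OF D_zeta_center]
  have z: "2 * gr < (gr - 1) / 2 + 3" "(gr - 1) / 2 + gr < 2"
    using D_zeta_center by (simp_all add: D_zeta_iff)
  let ?z = "((gr - 1) / 2, 0)"
  have "period ((U ^^ n) ?z) = enat (\<Sum>j<4. level_time n ((T_hat ^^ j) ?z))"
  proof (rule period_level)
    show "(T_hat ^^ j) ?z \<noteq> ?z" if "0 < j" "j < 4" for j
      using that zeta_path[OF z, unfolded times_divide_eq_right gr_simps] gr_bounds
      by (auto simp: less_Suc_eq numeral_eq_Suc)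
  qed (use D_zeta_center D_zeta_subset p in \<open>auto simp: field_simps\<close>)
  then show ?thesis unfolding D_zeta_center_eq using p by simp
qed

lemma period_D_zeta:
  assumes "z \<in> D_zeta" "z \<noteq> (1 / (2 * gr), 0)"
  shows "period ((U ^^ n) z) = enat (80 * repunit n + 50)"
proof -
  obtain x where z: "z = (x, 0)" using assms(1) by (cases z) (auto simp: D_zeta_iff)
  let ?z' = "(gr - 1 - x, 0)"
  have x: "(x, 0) \<in> D_zeta" using assms z by simp
  note p = T_hat_pow_4_D_zeta[OF x] and p' = T_hat_pow_4_D_zeta[OF T_hat_pow_4_D_zeta(2)[OF x]]
  have ne: "(T_hat ^^ 4) z \<noteq> z"
    using assms(2) unfolding z p(1) D_zeta_center_eq by auto
  have shift: "(T_hat ^^ (j + 4)) z = (T_hat ^^ j) ?z'" for j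
    by (simp add: funpow_add p(1) z del: funpow.simps)
  have "period ((U ^^ n) z) = enat (\<Sum>j<8. level_time n ((T_hat ^^ j) z))"
  proof (rule period_level)
    \<comment> \<open>The period under \<open>T_hat\<close> divides 8 and does not divide 4.\<close>
    show cyc: "(T_hat ^^ 8) z = z" using shift[of 4] p'(1) z by simp
    fix j :: nat
    assume j: "0 < j" "j < 8"
    show "(T_hat ^^ j) z \<noteq> z"
    proof
      assume "(T_hat ^^ j) z = z"
      then have g: "(T_hat ^^ gcd j 8) z = z" using cyc by (rule funpow_gcd)
      have "j = 1 \<or> j = 2 \<or> j = 3 \<or> j = 4 \<or> j = 5 \<or> j = 6 \<or> j = 7"
        using j by linarith
      then have "gcd j 8 dvd 4" by (auto simp: gcd_non_0_nat)
      then obtain k where "4 = gcd j 8 * k" by blast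
      then have "(T_hat ^^ 4) z = ((T_hat ^^ gcd j 8) ^^ k) z" by (simp add: funpow_mult)
      also have "\<dots> = z" by (induction k) (auto simp: g)
      finally show False using ne by simp
    qed
  qed (use assms D_zeta_subset in auto)
  also have "(\<Sum>j<8. level_time n ((T_hat ^^ j) z)) =
      (\<Sum>j<4. level_time n ((T_hat ^^ j) z)) + (\<Sum>j<4. level_time n ((T_hat ^^ j) ?z'))"
    unfolding shift[symmetric] by (simp add: numeral_eq_Suc)
  also have "\<dots> = 80 * repunit n + 50" using p(3) p'(3) z by simp
  finally show ?thesis .
qed

lemma T_hat_pow_eq_period:
  assumes "z \<in> D"
  shows "period ((U ^^ n) ((T_hat ^^ m) z)) = period ((U ^^ n) z)"
proof (rule period_same_orbit[OF same_orbit_sym])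
  show "same_orbit ((U ^^ n) z) ((U ^^ n) ((T_hat ^^ m) z))"
    using same_orbit_level_iter[OF assms, of n "int m"] by (simp add: T_hat_iter_def)
qed (use in_level level_subset_unit_square T_hat_pow_in_D[OF assms] assms in blast)+

text \<open>The two endpoints \<open>1 / gr ^ 2\<close> and \<open>1 / gr ^ 3\<close> of \<open>D_zeta\<close> behave differently from the segment:
  the former is fixed, the latter has period 2 under \<open>T_hat\<close>.\<close>

lemma corner_fixed: "(2 - gr, 0) \<in> D2" "T_hat (2 - gr, 0) = (2 - gr, 0)"
proof -
  show 1: "(2 - gr, 0) \<in> D2"
    using gr_bounds unfolding D2_iff D_iff gr_simps by simp
  show "T_hat (2 - gr, 0) = (2 - gr, 0)"
    unfolding T_hat_D2[OF 1] gr_simps by simp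
qed

lemma period_corner: "period ((U ^^ n) (1 / gr ^ 2, 0)) = enat (10 * repunit n + 7)"
  unfolding gr_inverse2 using period_level_fixed[of "(2 - gr, 0)" n] corner_fixed D_pieces_subset
  by (auto simp: level_time_simps)

lemma corner_2_cycle:
  "(2 * gr - 3, 0) \<in> D0" "T_hat (2 * gr - 3, 0) = (gr - 1, 2 * gr - 3)"
  "(gr - 1, 2 * gr - 3) \<in> D2" "T_hat (gr - 1, 2 * gr - 3) = (2 * gr - 3, 0)"
proof -
  show 1: "(2 * gr - 3, 0) \<in> D0"
    using gr_bounds unfolding D0_iff D_iff gr_simps by simp
  show 2: "(gr - 1, 2 * gr - 3) \<in> D2"
    using gr_bounds unfolding D2_iff D_iff gr_simps by simp
  show "T_hat (2 * gr - 3, 0) = (gr - 1, 2 * gr - 3)"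
    unfolding T_hat_D0[OF 1] by simp
  show "T_hat (gr - 1, 2 * gr - 3) = (2 * gr - 3, 0)"
    unfolding T_hat_D2[OF 2] gr_simps by simp
qed

lemma period_corner_2_cycle: "period ((U ^^ n) (1 / gr ^ 3, 0)) = enat (20 * repunit n + 13)"
proof -
  let ?z = "(2 * gr - 3, 0)"
  have "period ((U ^^ n) ?z) = enat (\<Sum>j<2. level_time n ((T_hat ^^ j) ?z))"
  proof (rule period_level)
    show "(T_hat ^^ j) ?z \<noteq> ?z" if "0 < j" "j < 2" for j
      using that corner_2_cycle gr_bounds by (auto simp: less_Suc_eq numeral_2_eq_2)
  qed (use corner_2_cycle D_pieces_subset in \<open>auto simp: numeral_2_eq_2\<close>)
  also have "(\<Sum>j<2. level_time n ((T_hat ^^ j) ?z)) = 20 * repunit n + 13"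
    using corner_2_cycle by (simp add: numeral_2_eq_2 level_time_simps)
  finally show ?thesis unfolding gr_inverse3 .
qed

section \<open>Orbits that avoid the shrunk triangle\<close>

text \<open>The sets \<open>D_alpha\<close> and \<open>D_beta\<close> are defined by two-sided orbits. On a cycle the backward iterates
  are also forward iterates.\<close>

lemma T_hat_iter_periodic:
  assumes z: "z \<in> D" and cyc: "(T_hat ^^ q) z = z" and "0 < q"
  shows "\<exists>j. T_hat_iter k z = (T_hat ^^ j) z"
proof -
  have "\<exists>j. (inv_into D T_hat ^^ i) z = (T_hat ^^ j) z" for i
  proof (induction i)
    case 0
    then show ?case by (intro exI[of _ 0]) simp
  next
    case (Suc i)
    then obtain j where j: "(inv_into D T_hat ^^ i) z = (T_hat ^^ j) z" by blast
    have "(T_hat ^^ j) z = T_hat ((T_hat ^^ (q - 1 + j)) z)"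
    proof -
      have "(T_hat ^^ Suc (q - 1 + j)) z = (T_hat ^^ (j + q)) z"
        using \<open>0 < q\<close> by (simp add: add.commute)
      also have "\<dots> = (T_hat ^^ j) z" by (simp only: funpow_add o_apply cyc)
      finally show ?thesis by simp
    qed
    then have "(inv_into D T_hat ^^ Suc i) z = (T_hat ^^ (q - 1 + j)) z"
      using j inv_into_f_f[OF inj_on_T_hat T_hat_pow_in_D[OF z]] by simp
    then show ?case by blast
  qed
  then show ?thesis by (auto simp: T_hat_iter_def)
qed

lemma D_alphaI:
  assumes "\<And>j. (T_hat ^^ j) z \<in> D0"
  shows "z \<in> D_alpha"
proof -
  have "z \<in> D" using assms[of 0] D_pieces_subset by auto
  moreover have "T_hat_iter k z \<in> D0" for k
    using T_hat_iter_periodic[OF \<open>z \<in> D\<close> T_hat_pow_5_D0[OF assms], of k] assms by auto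
  ultimately show ?thesis by (simp add: D_alpha_def)
qed

lemma D_betaI:
  assumes "\<And>j. (T_hat ^^ j) z \<in> D1"
  shows "z \<in> D_beta"
proof -
  have "z \<in> D" using assms[of 0] D_pieces_subset by auto
  moreover have "T_hat_iter k z \<in> D1" for k
    using T_hat_iter_periodic[OF \<open>z \<in> D\<close> T_hat_pow_5_D1[OF assms], of k] assms by auto
  ultimately show ?thesis by (simp add: D_beta_def)
qed

text \<open>The cycles through the closed segment from \<open>(1 / gr ^ 3, 0)\<close> to \<open>(1 / gr ^ 2, 0)\<close>, written as in
  the theorem.\<close>

definition zeta_cycles :: "(real \<times> real) set" where
  "zeta_cycles = (\<Union>m\<in>{0, 1, 2, 3}. (T_hat ^^ m) ` D_zeta) \<union> {(1 / gr ^ 2, 0)}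
     \<union> {(T_hat ^^ m) (1 / gr ^ 3, 0) | m. m \<in> {0, 1}}"

text \<open>These sets consist of whole cycles, and \<open>T_hat\<close> is injective, so nothing enters them from outside.\<close>

lemma zeta_cycles_preimage:
  assumes z: "z \<in> D" and T: "T_hat z \<in> zeta_cycles"
  shows "z \<in> zeta_cycles"
proof -
  have inj: "z = w" if "w \<in> D" "T_hat z = T_hat w" for w
    using inj_onD[OF inj_on_T_hat] that z by blast
  consider (zeta) m v where "m \<in> {0, 1, 2, 3}" "v \<in> D_zeta" "T_hat z = (T_hat ^^ m) v"
    | (fixed) "T_hat z = (2 - gr, 0)"
    | (0) "T_hat z = (2 * gr - 3, 0)" | (1) "T_hat z = T_hat (2 * gr - 3, 0)"
  proof -
    have "(\<exists>m\<in>{0, 1, 2, 3}. \<exists>v\<in>D_zeta. T_hat z = (T_hat ^^ m) v) \<or> T_hat z = (2 - gr, 0)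
      \<or> (\<exists>m\<in>{0, 1}. T_hat z = (T_hat ^^ m) (2 * gr - 3, 0))"
      using T unfolding zeta_cycles_def gr_inverse2 gr_inverse3 by blast
    then have "(\<exists>m\<in>{0, 1, 2, 3}. \<exists>v\<in>D_zeta. T_hat z = (T_hat ^^ m) v) \<or> T_hat z = (2 - gr, 0)
      \<or> T_hat z = (2 * gr - 3, 0) \<or> T_hat z = T_hat (2 * gr - 3, 0)"
      by simp
    then show ?thesis using that by blast
  qed
  then show ?thesis
  proof cases
    case zeta
    have "\<exists>k\<in>{0, 1, 2, 3}. \<exists>u\<in>D_zeta. T_hat z = T_hat ((T_hat ^^ k) u)"
    proof (cases m)
      case 0
      obtain x where v: "v = (x, 0)" using zeta(2) by (cases v) (auto simp: D_zeta_iff)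
      have u: "(gr - 1 - x, 0) \<in> D_zeta" using T_hat_pow_4_D_zeta(2) zeta(2) v by simp
      have "T_hat z = (T_hat ^^ 4) (gr - 1 - x, 0)"
        using zeta(3) 0 v T_hat_pow_4_D_zeta(1)[OF u] by simp
      then have "T_hat z = T_hat ((T_hat ^^ 3) (gr - 1 - x, 0))"
        by (simp add: numeral_eq_Suc)
      then show ?thesis using u by blast
    next
      case (Suc k)
      then show ?thesis using zeta by (intro bexI[of _ k] bexI[of _ v]) auto
    qed
    then obtain k u where "k \<in> {0, 1, 2, 3}" "u \<in> D_zeta" "z = (T_hat ^^ k) u"
      using inj T_hat_pow_in_D D_zeta_subset by blast
    then show ?thesis unfolding zeta_cycles_def by blast
  next
    case fixed
    then have "z = (2 - gr, 0)" using inj corner_fixed D_pieces_subset by auto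
    then show ?thesis by (simp add: zeta_cycles_def gr_inverse2)
  next
    case 0
    then have "z = T_hat (2 * gr - 3, 0)" using inj corner_2_cycle D_pieces_subset by auto
    then show ?thesis
      unfolding zeta_cycles_def gr_inverse3 by (auto intro: exI[of _ 1])
  next
    case 1
    then have "z = (2 * gr - 3, 0)" using inj corner_2_cycle D_pieces_subset by auto
    then show ?thesis
      unfolding zeta_cycles_def gr_inverse3 by (auto intro: exI[of _ 0])
  qed
qed

text \<open>The image of \<open>D2\<close> is the part \<open>0 < x \<le> 1 / gr ^ 2\<close> of the base; its points with
  \<open>x < 1 / gr ^ 3\<close> are in \<open>U ` D\<close>, and the others are on the closed segment of \<open>zeta_cycles\<close>.\<close>

lemma D2_never_UD:
  assumes "z \<in> D2" "T_hat z \<notin> U ` D"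
  shows "z \<in> zeta_cycles"
proof -
  obtain x y where z: "z = (x, y)" by force
  have d: "(x, y) \<in> D" and h: "y + 2 = x + gr" using assms(1) by (auto simp: D2_iff z)
  let ?x = "gr - 1 - gr * x + x"
  have T: "T_hat z = (?x, 0)" using assms(1) z by (simp add: T_hat_D2)
  have "gr * y + gr = gr * x + 1"
    using arg_cong[OF h, of "\<lambda>t. gr * t", unfolded gr_simps] by linarith
  then have le: "?x \<le> 2 - gr" using D_bounds[OF d] h by linarith
  have TD: "(?x, 0) \<in> D" using T_hat_in_D assms(1) T D_pieces_subset by fastforce
  then have "2 \<le> gr * ?x + gr"
    using assms(2) unfolding T UD_iff by (auto simp: D_iff)
  then have ge: "2 * gr - 3 \<le> ?x"
    using gr_scale_le[of 2 "gr * ?x + gr"] unfolding gr_simps by linarith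
  have "(?x, 0) \<in> zeta_cycles"
  proof -
    consider "?x = 2 - gr" | "?x = 2 * gr - 3" | "(?x, 0) \<in> D_zeta"
      using le ge unfolding D_zeta_iff by linarith
    then show ?thesis
    proof cases
      case 1
      then show ?thesis unfolding zeta_cycles_def gr_inverse2 by simp
    next
      case 2
      then show ?thesis unfolding zeta_cycles_def gr_inverse3 by (auto intro: exI[of _ 0])
    next
      case 3
      then show ?thesis unfolding zeta_cycles_def by force
    qed
  qed
  then show ?thesis
    using zeta_cycles_preimage[of z] T assms(1) D_pieces_subset by auto
qed

text \<open>A point that passes from \<open>D1\<close> to \<open>D0\<close> or \<open>D2\<close> is in \<open>U ` D\<close> at the latest one step later, and no
  point passes from \<open>D1\<close> to \<open>D3\<close>.\<close>

lemma D1_next: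
  assumes "z \<in> D1" "T_hat z \<notin> U ` D" "T_hat (T_hat z) \<notin> U ` D"
  shows "T_hat z \<in> D1"
proof -
  obtain x y where z: "z = (x, y)" by force
  have d: "(x, y) \<in> D" and h: "0 < y" "y + 2 < x + gr" using assms(1) by (auto simp: D1_iff z)
  note I = D_bounds[OF d] h h[THEN gr_scale, unfolded gr_simps]
  have T: "T_hat z = (gr - gr * x + y, 1 - x)" using assms(1) by (simp add: z T_hat_D1)
  have "T_hat z \<in> D" using assms(1) D_pieces_subset T_hat_in_D by blast
  then show ?thesis
  proof (cases rule: D_cases)
    case D0
    have T2: "T_hat (T_hat z) = (x - 2 + gr, y)"
      unfolding T T_hat_D0[OF D0[unfolded T]]
      by (rule prod_eqI; simp only: fst_conv snd_conv gr_simps; linarith)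
    have J: "gr - gr * x + y + gr < 1 - x + 2"
      using D0 unfolding T D0_iff by simp
    have "T_hat (T_hat z) \<in> U ` D"
      unfolding T2 UD_iff gr_simps
      by (insert I J gr_scale[OF J, unfolded gr_simps], intro conjI; linarith)
    then show ?thesis using assms(3) by simp
  next
    case D2
    let ?t = "gr - 1 - gr * (gr - gr * x + y) + (gr - gr * x + y)"
    have T2: "T_hat (T_hat z) = (?t, 0)"
      unfolding T T_hat_D2[OF D2[unfolded T]] ..
    then have "(?t, 0) \<in> D"
      using T_hat_in_D[of "T_hat z"] D2 D_pieces_subset by auto
    then have "0 < ?t" by (simp add: D_iff)
    then have "T_hat (T_hat z) \<in> U ` D"
      unfolding T2 UD_iff gr_simps by (insert I, intro conjI; linarith)
    then show ?thesis using assms(3) by simp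
  next
    case D3
    then show ?thesis
      using I unfolding T D3_iff by linarith
  qed
qed

lemma D0_next:
  assumes "z \<in> D0" "z \<notin> U ` D" "T_hat z \<notin> U ` D"
  shows "T_hat z \<in> D0 \<or> T_hat z \<in> D2"
proof -
  obtain x y where z: "z = (x, y)" by force
  have d: "(x, y) \<in> D" using assms(1) by (simp add: D0_iff z)
  have h: "y + 2 \<le> gr * x + gr" using assms(2) d unfolding z UD_iff D_iff by auto
  note I = D_bounds[OF d] gr_scale_le[OF h, unfolded gr_simps]
  have T: "T_hat z = (gr - 1 - y, x - gr * y)" using assms(1) by (simp add: z T_hat_D0)
  have "T_hat z \<in> D" using assms(1) D_pieces_subset T_hat_in_D by blast
  then show ?thesis
  proof (cases rule: D_cases)
    case D1
    then show ?thesis using I unfolding T D1_iff by linarith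
  next
    case D3
    then show ?thesis using I unfolding T D3_iff by linarith
  qed auto
qed

lemma never_UD_cases:
  assumes "z \<in> D" and never: "\<And>k. (T_hat ^^ k) z \<notin> U ` D"
  shows "z \<in> D_alpha \<union> D_beta \<union> D3 \<union> zeta_cycles"
  using \<open>z \<in> D\<close>
proof (cases rule: D_cases)
  case D0
  show ?thesis
  proof (cases "\<forall>j. (T_hat ^^ j) z \<in> D0")
    case True
    then show ?thesis using D_alphaI by blast
  next
    case False
    define j where "j = (LEAST j. (T_hat ^^ j) z \<notin> D0)"
    have j: "(T_hat ^^ j) z \<notin> D0" and below: "\<And>i. i < j \<Longrightarrow> (T_hat ^^ i) z \<in> D0"
      using LeastI_ex[of "\<lambda>j. (T_hat ^^ j) z \<notin> D0"] not_less_Least False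
      unfolding j_def by auto
    then obtain i where i: "j = Suc i" using D0 by (cases j) auto
    have "(T_hat ^^ j) z \<in> D2"
      using D0_next[of "(T_hat ^^ i) z"] below[of i] never[of i] never[of j] j i by auto
    then have "(T_hat ^^ j) z \<in> zeta_cycles"
      using D2_never_UD never[of "Suc j"] by simp
    then have "z \<in> zeta_cycles"
    proof (induction j)
      case (Suc j)
      then show ?case
        using zeta_cycles_preimage[OF T_hat_pow_in_D[OF \<open>z \<in> D\<close>]] by simp
    qed simp
    then show ?thesis by simp
  qed
next
  case D1
  have "(T_hat ^^ j) z \<in> D1" for j
  proof (induction j)
    case (Suc j)
    then show ?case
      using D1_next[of "(T_hat ^^ j) z"] never[of "Suc j"] never[of "Suc (Suc j)"] by simp
  qed (simp add: D1)
  then show ?thesis using D_betaI by simp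
next
  case D2
  then show ?thesis using D2_never_UD never[of 1] by simp
qed simp

lemma P_subset: "P \<subseteq> D_alpha \<union> D_beta \<union> D3 \<union> zeta_cycles"
proof
  fix z
  assume z: "z \<in> P"
  have "(T_hat ^^ k) z \<notin> U ` D" for k
    using z by (auto simp: P_def T_hat_iter_def dest: spec[of _ "int k"])
  then show "z \<in> D_alpha \<union> D_beta \<union> D3 \<union> zeta_cycles"
    using never_UD_cases z by (simp add: P_def)
qed

section \<open>Every point except the origin reaches the triangle\<close>

lemma reaches_D_step:
  assumes "T z = w" "\<exists>m. (T ^^ m) w \<in> D"
  shows "\<exists>m. (T ^^ m) z \<in> D"
proof -
  obtain m where "(T ^^ m) w \<in> D" using assms by blast
  then have "(T ^^ Suc m) z \<in> D" using assms(1) by (simp add: funpow_swap1)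
  then show ?thesis by blast
qed

lemma in_D_reaches_D: "z \<in> D \<Longrightarrow> \<exists>m. (T ^^ m) z \<in> D"
  by (rule exI[of _ 0]) simp

text \<open>Here \<open>T\<close> is linear, without a jump, and acts as a rotation by 36 degrees in suitable
  coordinates. What lies to the left of \<open>D\<close> consists of three sectors of that angle
  and the vertical axis, which arrive in \<open>D\<close> after one, two, three and four steps, and no jump
  occurs before.\<close>

lemma reaches_D_left:
  assumes sq: "0 \<le> x" "x < 1" "0 \<le> y" "y < 1" and left: "x \<le> gr * y" "gr * y < x + 1"
    and ne: "(x, y) \<noteq> (0, 0)"
  shows "\<exists>m. (T ^^ m) (x, y) \<in> D"
proof -
  note I = sq left gr_bounds sq(1,3)[THEN gr_scale_le, unfolded gr_simps]
    sq(2,4)[THEN gr_scale, unfolded gr_simps]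
  have T1: "T (x, y) = (y, gr * y - x)"
    by (rule T_eq[where c = 0]) (insert I, simp_all)
  show ?thesis
  proof (rule reaches_D_step[OF T1], cases "y < x")
    case True
    have "(y, gr * y - x) \<in> D"
      unfolding D_iff gr_simps
      by (insert I True gr_scale[OF True, unfolded gr_simps], intro conjI; linarith)
    then show "\<exists>m. (T ^^ m) (y, gr * y - x) \<in> D" by (rule in_D_reaches_D)
  next
    case False
    then have le: "x \<le> y" by simp
    note J = I le gr_scale_le[OF le, unfolded gr_simps]
    have T2: "T (y, gr * y - x) = (gr * y - x, gr * y - gr * x)"
      by (rule T_eq[where c = 0]; (simp; fail)?) (insert J, unfold gr_simps, linarith+)
    show "\<exists>m. (T ^^ m) (y, gr * y - x) \<in> D"
    proof (rule reaches_D_step[OF T2], cases "y < gr * x")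
      case True
      have "(gr * y - x, gr * y - gr * x) \<in> D"
        unfolding D_iff gr_simps by (insert J True, intro conjI; linarith)
      then show "\<exists>m. (T ^^ m) (gr * y - x, gr * y - gr * x) \<in> D" by (rule in_D_reaches_D)
    next
      case False
      then have "gr * x \<le> y" by simp
      note K = J this gr_scale_le[OF this, unfolded gr_simps]
      have T3: "T (gr * y - x, gr * y - gr * x) = (gr * y - gr * x, y - gr * x)"
        by (rule T_eq[where c = 0]; (simp; fail)?) (insert K, unfold gr_simps, linarith+)
      show "\<exists>m. (T ^^ m) (gr * y - x, gr * y - gr * x) \<in> D"
      proof (rule reaches_D_step[OF T3], cases "x = 0")
        case True
        have T4: "T (gr * y - gr * x, y - gr * x) = (y - gr * x, 0)"
          by (rule T_eq[where c = 0]) (use True in simp_all)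
        have "y > 0" using ne sq True by auto
        then have "(y - gr * x, 0) \<in> D" using left True by (simp add: D_iff)
        then show "\<exists>m. (T ^^ m) (gr * y - gr * x, y - gr * x) \<in> D"
          using reaches_D_step[OF T4] in_D_reaches_D by blast
      next
        case False
        then have "0 < x" using sq by simp
        then have "(gr * y - gr * x, y - gr * x) \<in> D"
          unfolding D_iff gr_simps by (insert K, intro conjI; linarith)
        then show "\<exists>m. (T ^^ m) (gr * y - gr * x, y - gr * x) \<in> D" by (rule in_D_reaches_D)
      qed
    qed
  qed
qed

text \<open>One step leads to the region of \<open>reaches_D_left\<close>.\<close>

lemma reaches_D_right:
  assumes sq: "0 \<le> x" "x < 1" "0 \<le> y" "y < 1" and right: "y + 1 \<le> gr * x"
  shows "\<exists>m. (T ^^ m) (x, y) \<in> D"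
proof -
  note I = sq right gr_bounds sq(1,3)[THEN gr_scale_le, unfolded gr_simps]
    sq(2,4)[THEN gr_scale, unfolded gr_simps] gr_scale_le[OF right, unfolded gr_simps]
  have T: "T (x, y) = (y, 1 - x + gr * y)"
    by (rule T_eq[where c = "-1"]; (simp; fail)?) (insert I, linarith+)
  show ?thesis
    by (rule reaches_D_step[OF T], rule reaches_D_left; (simp add: sq; fail)?)
      (insert I, unfold gr_simps, (linarith | auto)+)
qed

lemma Rset_subset: "Rset \<subseteq> {(0, 0)}"
proof -
  have "\<exists>m. (T ^^ m) (x, y) \<in> D"
    if sq: "0 \<le> x" "x < 1" "0 \<le> y" "y < 1" and ne: "(x, y) \<noteq> (0, 0)" for x y
  proof -
    note I = sq gr_bounds sq(1,3)[THEN gr_scale_le, unfolded gr_simps]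
      sq(2,4)[THEN gr_scale, unfolded gr_simps]
    consider "(x, y) \<in> D" | "y + 1 \<le> gr * x" | "x \<le> gr * y" "gr * y < x + 1" | "x + 1 \<le> gr * y"
      using sq unfolding D_iff by linarith
    then show ?thesis
    proof cases
      case 4
      have T: "T (x, y) = (y, gr * y - x - 1)"
        by (rule T_eq[where c = 1]; (simp; fail)?) (insert I 4, linarith+)
      show ?thesis
        by (rule reaches_D_step[OF T], rule reaches_D_right; (simp add: sq; fail)?)
          (insert I 4, linarith+)
    qed (use sq ne in_D_reaches_D reaches_D_right reaches_D_left in blast)+
  qed
  then have "(x, y) = (0, 0)" if "(x, y) \<in> Rset" for x y
    using that by (simp add: Rset_def unit_square_def del: prod.inject) blast
  then show ?thesis by auto
qed

section \<open>The periods\<close>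

lemma T_origin: "T (0, 0) = (0, 0)"
  by (simp add: T_def)

lemma period_origin: "period (0, 0) = 1"
proof -
  have "first_return T {(0, 0)} (0, 0) 1 (0, 0)"
    using first_return_1[of T "(0, 0)" "{(0, 0)}"] by (simp add: T_origin)
  then show ?thesis by (simp add: period_first_return one_enat_def)
qed

lemma four_power: "4 ^ n = 3 * repunit n + 1"
  by (induction n) auto

lemma le_repunit: "n \<le> repunit n"
  by (induction n) auto

text \<open>A point of period \<open>p\<close> that is on the orbit of a point \<open>(U ^^ p) w\<close> of level \<open>p\<close> would bring the
  latter back to its level after \<open>p\<close> steps, although the return time at level \<open>p\<close> exceeds \<open>p\<close>.\<close>

lemma period_infinite:
  assumes s: "hit_choice s" and all: "\<And>n. \<exists>w\<in>D. SR s n z = Some w"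
  shows "period z = \<infinity>"
proof (rule ccontr)
  assume "period z \<noteq> \<infinity>"
  then have "\<exists>p\<ge>1. (T ^^ p) z = z" unfolding period_def by metis
  then obtain p where p: "period z = enat p" "1 \<le> p"
    unfolding period_def using LeastI_ex[of "\<lambda>p. 1 \<le> p \<and> (T ^^ p) z = z"] by auto
  obtain w where w: "w \<in> D" "SR s p z = Some w" using all by blast
  let ?e = "(U ^^ p) w"
  have "period ?e = enat p" using SR_period[OF s w(2)] p by simp
  then have "(T ^^ p) ?e = ?e"
    unfolding period_def using LeastI_ex[of "\<lambda>p. 1 \<le> p \<and> (T ^^ p) ?e = ?e"]
    by (auto split: if_splits)
  moreover have "p < level_time p w"
    using le_repunit[of p] by (auto simp: level_time_def)
  moreover have "(T ^^ k) ?e \<notin> level p" if "0 < k" "k < level_time p w" for k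
    using level_return[OF w(1), of p] that by (simp add: first_return_def)
  ultimately show False
    using in_level[OF w(1), of p] p(2) by (metis less_eq_Suc_le One_nat_def)
qed

lemma SR_cases:
  assumes s: "hit_choice s" and z: "z \<in> unit_square"
  shows "z = (0, 0) \<or> (\<exists>n. \<exists>w\<in>P. SR s n z = Some w) \<or> (\<forall>n. \<exists>w\<in>D - P. SR s n z = Some w)"
proof (cases "z = (0, 0) \<or> (\<exists>n. \<exists>w\<in>P. SR s n z = Some w)")
  case False
  have "\<exists>w\<in>D - P. SR s n z = Some w" for n
  proof -
    have "\<exists>w. SR s n z = Some w"
    proof (induction n)
      case 0
      then show ?case using False z Rset_subset by auto
    next
      case (Suc n)
      then obtain w where "SR s n z = Some w" by blast
      then show ?case using SR_same_orbit[OF s] False by fastforce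
    qed
    then show ?thesis using SR_same_orbit[OF s] False by blast
  qed
  then show ?thesis by blast
qed blast

theorem theorem7p1:
  fixes s :: "real \<times> real \<Rightarrow> int" and z :: "real \<times> real"
  assumes "hit_choice s" and "z \<in> unit_square"
  shows
    "(z = (0, 0) \<longrightarrow> period z = 1)
   \<and> (\<forall>n. SR s n z = Some c_alpha \<longrightarrow> period z = enat (2 * (5 * 4 ^ n + 4) div 3))
   \<and> (\<forall>n. (\<exists>w \<in> D_alpha. SR s n z = Some w) \<and> \<not> (\<exists>k. SR s k z = Some c_alpha)
        \<longrightarrow> period z = enat (10 * (5 * 4 ^ n + 4) div 3))
   \<and> (\<forall>n. SR s n z = Some c_beta \<longrightarrow> period z = enat (4 * (5 * 4 ^ n - 2) div 3))
   \<and> (\<forall>n. (\<exists>w \<in> D_beta. SR s n z = Some w) \<and> \<not> (\<exists>k. SR s k z = Some c_beta)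
        \<longrightarrow> period z = enat (20 * (5 * 4 ^ n - 2) div 3))
   \<and> (\<forall>n. SR s n z = Some (1 / 2, 0) \<longrightarrow> period z = enat (5 * (4 ^ (n + 1) - 1) div 3))
   \<and> (\<forall>n. (\<exists>w \<in> D3. SR s n z = Some w) \<and> \<not> (\<exists>k. SR s k z = Some (1 / 2, 0))
        \<longrightarrow> period z = enat (10 * (4 ^ (n + 1) - 1) div 3))
   \<and> (\<forall>n. (\<exists>m \<in> {0, 1, 2, 3}. SR s n z = Some ((T_hat ^^ m) (1 / (2 * gr), 0)))
        \<longrightarrow> period z = enat (5 * (2 * 4 ^ (n + 1) + 7) div 3))
   \<and> (\<forall>n. (\<exists>m \<in> {0, 1, 2, 3}. \<exists>w \<in> (T_hat ^^ m) ` D_zeta. SR s n z = Some w)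
          \<and> \<not> (\<exists>k. \<exists>m \<in> {0, 1, 2, 3}. SR s k z = Some ((T_hat ^^ m) (1 / (2 * gr), 0)))
        \<longrightarrow> period z = enat (10 * (2 * 4 ^ (n + 1) + 7) div 3))
   \<and> (\<forall>n. SR s n z = Some (1 / gr ^ 2, 0) \<longrightarrow> period z = enat ((10 * 4 ^ n + 11) div 3))
   \<and> (\<forall>n. (\<exists>m \<in> {0, 1}. SR s n z = Some ((T_hat ^^ m) (1 / gr ^ 3, 0)))
        \<longrightarrow> period z = enat ((5 * 4 ^ (n + 1) + 19) div 3))
   \<and> ((\<forall>n. \<exists>w \<in> D - P. SR s n z = Some w) \<longrightarrow> period z = \<infinity>)
   \<and> (z = (0, 0)
      \<or> (\<exists>n. \<exists>w \<in> {c_alpha} \<union> D_alpha \<union> {c_beta} \<union> D_beta \<union> {(1 / 2, 0)} \<union> D3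
               \<union> {(T_hat ^^ m) (1 / (2 * gr), 0) | m. m \<in> {0, 1, 2, 3}}
               \<union> (\<Union>m \<in> {0, 1, 2, 3}. (T_hat ^^ m) ` D_zeta)
               \<union> {(1 / gr ^ 2, 0)}
               \<union> {(T_hat ^^ m) (1 / gr ^ 3, 0) | m. m \<in> {0, 1}}.
            SR s n z = Some w)
      \<or> (\<forall>n. \<exists>w \<in> D - P. SR s n z = Some w))"
proof (intro conjI allI impI; (elim conjE bexE)?)
  note per = SR_period[OF \<open>hit_choice s\<close>, of _ z]
  have center: "(1 / (2 * gr), 0) \<in> D"
    using D_zeta_center D_zeta_subset unfolding D_zeta_center_eq by blast
  show "period z = 1" if "z = (0, 0)"
    using period_origin that by simp
  fix n
  show "period z = enat (2 * (5 * 4 ^ n + 4) div 3)" if "SR s n z = Some c_alpha"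
    using per[OF that] by (simp add: period_c_alpha four_power)
  show "period z = enat (4 * (5 * 4 ^ n - 2) div 3)" if "SR s n z = Some c_beta"
    using per[OF that] by (simp add: period_c_beta four_power)
  show "period z = enat (5 * (4 ^ (n + 1) - 1) div 3)" if "SR s n z = Some (1 / 2, 0)"
    using per[OF that] by (simp add: period_half four_power)
  show "period z = enat ((10 * 4 ^ n + 11) div 3)" if "SR s n z = Some (1 / gr ^ 2, 0)"
    using per[OF that] by (simp add: period_corner four_power)
  show "period z = enat (10 * (5 * 4 ^ n + 4) div 3)"
    if "\<not> (\<exists>k. SR s k z = Some c_alpha)" "w \<in> D_alpha" "SR s n z = Some w" for w
  proof -
    have "w \<noteq> c_alpha" using that by blast
    then show ?thesis
      using per[OF that(3)] period_D_alpha[OF that(2), of n] by (simp add: four_power)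
  qed
  show "period z = enat (20 * (5 * 4 ^ n - 2) div 3)"
    if "\<not> (\<exists>k. SR s k z = Some c_beta)" "w \<in> D_beta" "SR s n z = Some w" for w
  proof -
    have "w \<noteq> c_beta" using that by blast
    then show ?thesis
      using per[OF that(3)] period_D_beta[OF that(2), of n] by (simp add: four_power)
  qed
  show "period z = enat (10 * (4 ^ (n + 1) - 1) div 3)"
    if "\<not> (\<exists>k. SR s k z = Some (1 / 2, 0))" "w \<in> D3" "SR s n z = Some w" for w
  proof -
    have "w \<noteq> (1 / 2, 0)" using that by blast
    then show ?thesis
      using per[OF that(3)] period_D3[OF that(2), of n] by (simp add: four_power)
  qed
  show "period z = enat (5 * (2 * 4 ^ (n + 1) + 7) div 3)"
    if "SR s n z = Some ((T_hat ^^ m) (1 / (2 * gr), 0))" for m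
    using per[OF that] T_hat_pow_eq_period[OF center] period_D_zeta_center
    by (simp add: four_power)
  show "period z = enat (10 * (2 * 4 ^ (n + 1) + 7) div 3)"
    if not_center:
      "\<not> (\<exists>k. \<exists>m \<in> {0, 1, 2, 3}. SR s k z = Some ((T_hat ^^ m) (1 / (2 * gr), 0)))"
      and m: "m \<in> {0, 1, 2, 3}"
      and w: "w \<in> (T_hat ^^ m) ` D_zeta" "SR s n z = Some w" for m w
  proof -
    obtain v where v: "v \<in> D_zeta" "w = (T_hat ^^ m) v" using w(1) by blast
    then have "v \<noteq> (1 / (2 * gr), 0)" using not_center m w(2) by blast
    then have "period ((U ^^ n) v) = enat (80 * repunit n + 50)"
      using v(1) by (rule period_D_zeta[rotated])
    moreover have "period z = period ((U ^^ n) v)"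
      unfolding per[OF w(2)] v(2)
      using v(1) D_zeta_subset by (intro T_hat_pow_eq_period) blast
    ultimately show ?thesis
      by (simp add: four_power)
  qed
  show "period z = enat ((5 * 4 ^ (n + 1) + 19) div 3)"
    if "SR s n z = Some ((T_hat ^^ m) (1 / gr ^ 3, 0))" for m
  proof -
    have "(1 / gr ^ 3, 0) \<in> D"
      using corner_2_cycle(1) D_pieces_subset unfolding gr_inverse3 by blast
    then show ?thesis
      using per[OF that] T_hat_pow_eq_period period_corner_2_cycle
      by (simp add: four_power)
  qed
next
  show "period z = \<infinity>" if "\<forall>n. \<exists>w\<in>D - P. SR s n z = Some w"
    using period_infinite[OF \<open>hit_choice s\<close>, of z] that by blast
next
  have sub: "P \<subseteq> {c_alpha} \<union> D_alpha \<union> {c_beta} \<union> D_beta \<union> {(1 / 2, 0)} \<union> D3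
               \<union> {(T_hat ^^ m) (1 / (2 * gr), 0) | m. m \<in> {0, 1, 2, 3}}
               \<union> (\<Union>m \<in> {0, 1, 2, 3}. (T_hat ^^ m) ` D_zeta)
               \<union> {(1 / gr ^ 2, 0)}
               \<union> {(T_hat ^^ m) (1 / gr ^ 3, 0) | m. m \<in> {0, 1}}" (is "_ \<subseteq> ?classes")
    using P_subset unfolding zeta_cycles_def by blast
  have classes: "\<exists>n. \<exists>w \<in> ?classes. SR s n z = Some w" if "w \<in> P" "SR s n z = Some w" for n w
  proof (rule exI, rule bexI)
    show "SR s n z = Some w" by (rule that(2))
    show "w \<in> ?classes" by (rule subsetD[OF sub that(1)])
  qed
  show "z = (0, 0) \<or> (\<exists>n. \<exists>w \<in> ?classes. SR s n z = Some w)
      \<or> (\<forall>n. \<exists>w \<in> D - P. SR s n z = Some w)" (is "?origin \<or> ?in_P \<or> ?never_in_P")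
  proof (rule disjE[OF SR_cases[OF assms]], goal_cases)
    case 1
    then show ?case ..
  next
    case 2
    then have "?in_P \<or> ?never_in_P"
    proof
      assume "\<exists>n. \<exists>w \<in> P. SR s n z = Some w"
      then have ?in_P using classes by (elim exE bexE)
      then show ?thesis ..
    qed (rule disjI2)
    then show ?case ..
  qed
qed

end
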